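(* Let $\mathcal A$ be a weakly idempotent complete additive category. (a) If $(\mathrm{CoFib}, \mathrm{Fib}, \mathrm{Weq})$ is a fibrant model structure on $\mathcal A$, and $\mathrm{TCoFib}=\mathrm{CoFib}\cap\mathrm{Weq}$, $\mathrm{TFib}=\mathrm{Fib}\cap\mathrm{Weq}$, then $(\mathrm{CoFib},\mathrm{TFib})$ is a fibrantly weak factorization system on $\mathcal A$, and $$\mathrm{Fib}=\{\text{morphism } f\mid f\text{ is }\mathrm{Hom}_{\mathcal A}(\mathrm{T}\mathcal C,-)\text{-epic}\},\qquad \mathrm{TCoFib}=\{\text{splitting monomorphism } f\mid \mathrm{Coker} f\in \mathrm{T}\mathcal C\},$$ where $\mathcal C=\{X\mid (0\to X)\in\mathrm{CoFib}\}$, $\mathcal W=\{X\mid (X\to 0)\in\mathrm{TFib}\}$ and $\mathrm{T}\mathcal C=\mathcal C\cap\mathcal W$. (b) Conversely, let $(\mathrm{CoFib},\mathrm{TFib})$ be a fibrantly weak factorization system on $\mathcal A$. Put $$\mathcal C=\{X\mid (0\to X)\in\mathrm{CoFib}\},\quad \mathcal W=\{X\mid (X\to 0)\in\mathrm{TFib}\},\quad \mathrm{T}\mathcal C=\mathcal C\cap\mathcal W,$$ $$\mathrm{Fib}=\{\text{morphism } f\mid f\text{ is }\mathrm{Hom}_{\mathcal A}(\mathrm{T}\mathcal C,-)\text{-epic}\},\quad \mathrm{TCoFib}=\{\text{splitting monomorphism } f\mid \mathrm{Coker} f\in \mathrm{T}\mathcal C\},$$ $$\mathrm{Weq}=\mathrm{TFib}\circ\mathrm{TCoFib}=\{\,p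 i\mid i\in\mathrm{TCoFib},\ p\in\mathrm{TFib}\text{ composable}\,\}.$$ Then $(\mathrm{CoFib},\mathrm{Fib},\mathrm{Weq})$ is a fibrant model structure on $\mathcal A$.
   Context: An additive category is weakly idempotent complete if every splitting monomorphism (morphism with a left inverse) has a cokernel, or equivalently every splitting epimorphism (morphism with a right inverse) has a kernel. For morphisms $f:A\to B$, $g:C\to D$ write $f\,\square\, g$ if for all $u:A\to C$, $v:B\to D$ with $gu=vf$ there is $h:B\to C$ with $hf=u$ and $gh=v$. A morphism $g:A'\to B'$ is a retract of $f:A\to B$ if there are $\varphi_1:A'\to A$, $\psi_1:A\to A'$, $\varphi_2:B'\to B$, $\psi_2:B\to B'$ with $f\varphi_1=\varphi_2 g$, $g\psi_1=\psi_2 f$, $\psi_1\varphi_1=\mathrm{Id}_{A'}$, $\psi_2\varphi_2=\mathrm{Id}_{B'}$. A model structure on a category $\mathcal M$ (no existence of limits or colimits is required) is a triple $(\mathrm{CoFib},\mathrm{Fib},\mathrm{Weq})$ of classes of morphisms such that: (two out of three) for composable $f,g$, if two of $f,g,gf$ are in $\mathrm{Weq}$, so is the third; (retract) each of the three classes is closed under retracts; (lifting) if $f\in\mathrm{CoFib}$, $g\in\mathrm{Fib}$ and either $f\in\mathrm{Weq}$ or $g\in\mathrm{Weq}$, then $f\,\square\, g$; (factorization) every morphism $f$ admits factorizations $f=pi$ and $f=qj$ with $i\in\mathrm{CoFib}\cap\mathrm{Weq}$, $p\in\mathrm{Fib}$, $j\in\mathrm{CoFib}$, $q\in\mathrm{Fib}\cap\mathrm{Weq}$.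 On a category with zero object it is fibrant if every object $X$ is fibrant, i.e. $(X\to 0)\in\mathrm{Fib}$. A pair $(\mathrm L,\mathrm R)$ of classes of morphisms is a weak factorization system if: both $\mathrm L$ and $\mathrm R$ are closed under retracts; $l\,\square\, r$ for all $l\in\mathrm L$, $r\in\mathrm R$; every morphism $f$ factors as $f=rl$ with $l\in\mathrm L$, $r\in\mathrm R$. On a category with zero object, $(\mathrm L,\mathrm R)$ is a fibrantly weak factorization system if: (1) it is a weak factorization system; (2) for $f:A\to B$, $g:B\to C$, if $f,gf\in\mathrm R$ then $g\in\mathrm R$; (3) the class of objects $\mathcal L\cap\mathcal R$ is contravariantly finite, where $\mathcal L=\{X\mid (0\to X)\in\mathrm L\}$ and $\mathcal R=\{X\mid (X\to 0)\in\mathrm R\}$. A class $\mathcal U$ of objects is contravariantly finite in $\mathcal A$ if every object $B$ has a right $\mathcal U$-approximation, i.e. a morphism $t:U\to B$ with $U\in\mathcal U$ such that every morphism $U'\to B$ with $U'\in\mathcal U$ factors through $t$. A morphism $f$ is $\mathrm{Hom}_{\mathcal A}(\mathcal U,-)$-epic if $\mathrm{Hom}_{\mathcal A}(U,f)$ is surjective for every $U\in\mathcal U$. *)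

theory Defs
  imports "HOL-Algebra.Group"
begin

section \<open>Categories with partial composition\<close>

record ('o, 'm) cat =
  obj :: "'o set"
  arr :: "'m set"
  src :: "'m \<Rightarrow> 'o"
  tgt :: "'m \<Rightarrow> 'o"
  idm :: "'o \<Rightarrow> 'm"
  comp :: "'m \<Rightarrow> 'm \<Rightarrow> 'm"  (infixl "\<cdot>\<index>" 70)

text \<open>The value of \<open>g \<cdot> f\<close> is meaningful only when \<open>f\<close>, \<open>g\<close> are morphisms with
  \<open>tgt f = src g\<close>.\<close>

definition homset :: "('o, 'm, 'z) cat_scheme \<Rightarrow> 'o \<Rightarrow> 'o \<Rightarrow> 'm set" where
  "homset C X Y = {f \<in> arr C. src C f = X \<and> tgt C f = Y}"

locale category =
  fixes C (structure)
  assumes src_obj: "f \<in> arr C \<Longrightarrow> src C f \<in> obj C"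
    and tgt_obj: "f \<in> arr C \<Longrightarrow> tgt C f \<in> obj C"
    and idm_hom: "X \<in> obj C \<Longrightarrow> idm C X \<in> homset C X X"
    and comp_hom: "\<lbrakk>f \<in> homset C X Y; g \<in> homset C Y Z\<rbrakk> \<Longrightarrow> g \<cdot> f \<in> homset C X Z"
    and comp_assoc: "\<lbrakk>f \<in> homset C W X; g \<in> homset C X Y; h \<in> homset C Y Z\<rbrakk>
          \<Longrightarrow> (h \<cdot> g) \<cdot> f = h \<cdot> (g \<cdot> f)"
    and idm_right: "f \<in> homset C X Y \<Longrightarrow> f \<cdot> idm C X = f"
    and idm_left: "f \<in> homset C X Y \<Longrightarrow> idm C Y \<cdot> f = f"


section \<open>Zero objects\<close>

definition is_zero_obj :: "('o, 'm, 'z) cat_scheme \<Rightarrow> 'o \<Rightarrow> bool" where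
  "is_zero_obj C Z \<longleftrightarrow> Z \<in> obj C \<and>
     (\<forall>X\<in>obj C. (\<exists>!f. f \<in> homset C Z X) \<and> (\<exists>!f. f \<in> homset C X Z))"

text \<open>A fixed choice of the object \<open>0\<close>. Classes of morphisms closed under retracts
  are closed under isomorphism of morphisms, so for them the choice is immaterial.
  The constants of this section are meaningful only for categories that have a zero
  object.\<close>

definition zero_obj :: "('o, 'm, 'z) cat_scheme \<Rightarrow> 'o" where
  "zero_obj C = (SOME Z. is_zero_obj C Z)"

definition from_zero :: "('o, 'm, 'z) cat_scheme \<Rightarrow> 'o \<Rightarrow> 'm" where
  "from_zero C X = (THE f. f \<in> homset C (zero_obj C) X)"

definition to_zero :: "('o, 'm, 'z) cat_scheme \<Rightarrow> 'o \<Rightarrow> 'm" where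
  "to_zero C X = (THE f. f \<in> homset C X (zero_obj C))"

definition objs_from_zero :: "('o, 'm, 'z) cat_scheme \<Rightarrow> 'm set \<Rightarrow> 'o set" where
  "objs_from_zero C L = {X \<in> obj C. from_zero C X \<in> L}"

definition objs_to_zero :: "('o, 'm, 'z) cat_scheme \<Rightarrow> 'm set \<Rightarrow> 'o set" where
  "objs_to_zero C R = {X \<in> obj C. to_zero C X \<in> R}"


section \<open>Lifting, retracts, approximations\<close>

definition lifts :: "('o, 'm, 'z) cat_scheme \<Rightarrow> 'm \<Rightarrow> 'm \<Rightarrow> bool" where
  "lifts C f g \<longleftrightarrow>
     (\<forall>u \<in> homset C (src C f) (src C g). \<forall>v \<in> homset C (tgt C f) (tgt C g).
        g \<cdot>\<^bsub>C\<^esub> u = v \<cdot>\<^bsub>C\<^esub> f \<longrightarrow>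
        (\<exists>h \<in> homset C (tgt C f) (src C g). h \<cdot>\<^bsub>C\<^esub> f = u \<and> g \<cdot>\<^bsub>C\<^esub> h = v))"

definition retract_of :: "('o, 'm, 'z) cat_scheme \<Rightarrow> 'm \<Rightarrow> 'm \<Rightarrow> bool" where
  "retract_of C g f \<longleftrightarrow> g \<in> arr C \<and> f \<in> arr C \<and>
     (\<exists>\<phi>\<^sub>1 \<in> homset C (src C g) (src C f). \<exists>\<psi>\<^sub>1 \<in> homset C (src C f) (src C g).
      \<exists>\<phi>\<^sub>2 \<in> homset C (tgt C g) (tgt C f). \<exists>\<psi>\<^sub>2 \<in> homset C (tgt C f) (tgt C g).
        f \<cdot>\<^bsub>C\<^esub> \<phi>\<^sub>1 = \<phi>\<^sub>2 \<cdot>\<^bsub>C\<^esub> g \<and> g \<cdot>\<^bsub>C\<^esub> \<psi>\<^sub>1 = \<psi>\<^sub>2 \<cdot>\<^bsub>C\<^esub> f \<and>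
        \<psi>\<^sub>1 \<cdot>\<^bsub>C\<^esub> \<phi>\<^sub>1 = idm C (src C g) \<and> \<psi>\<^sub>2 \<cdot>\<^bsub>C\<^esub> \<phi>\<^sub>2 = idm C (tgt C g))"

definition retract_closed :: "('o, 'm, 'z) cat_scheme \<Rightarrow> 'm set \<Rightarrow> bool" where
  "retract_closed C S \<longleftrightarrow> (\<forall>f g. f \<in> S \<longrightarrow> retract_of C g f \<longrightarrow> g \<in> S)"

definition compose_classes :: "('o, 'm, 'z) cat_scheme \<Rightarrow> 'm set \<Rightarrow> 'm set \<Rightarrow> 'm set" where
  "compose_classes C P I = {p \<cdot>\<^bsub>C\<^esub> i | p i. p \<in> P \<and> i \<in> I \<and> tgt C i = src C p}"

definition right_approximation :: "('o, 'm, 'z) cat_scheme \<Rightarrow> 'o set \<Rightarrow> 'o \<Rightarrow> 'm \<Rightarrow> bool" where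
  "right_approximation C \<U> B t \<longleftrightarrow> t \<in> arr C \<and> src C t \<in> \<U> \<and> tgt C t = B \<and>
     (\<forall>U\<in>\<U>. \<forall>f \<in> homset C U B. \<exists>h \<in> homset C U (src C t). f = t \<cdot>\<^bsub>C\<^esub> h)"

definition contravariantly_finite :: "('o, 'm, 'z) cat_scheme \<Rightarrow> 'o set \<Rightarrow> bool" where
  "contravariantly_finite C \<U> \<longleftrightarrow> (\<forall>B \<in> obj C. \<exists>t. right_approximation C \<U> B t)"

definition hom_epic :: "('o, 'm, 'z) cat_scheme \<Rightarrow> 'o set \<Rightarrow> 'm \<Rightarrow> bool" where
  "hom_epic C \<U> f \<longleftrightarrow>
     (\<forall>U\<in>\<U>. (\<lambda>h. f \<cdot>\<^bsub>C\<^esub> h) ` homset C U (src C f) = homset C U (tgt C f))"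


section \<open>Model structures and weak factorization systems\<close>

definition model_structure ::
    "('o, 'm, 'z) cat_scheme \<Rightarrow> 'm set \<Rightarrow> 'm set \<Rightarrow> 'm set \<Rightarrow> bool" where
  "model_structure C CoFib Fib Weq \<longleftrightarrow>
     CoFib \<subseteq> arr C \<and> Fib \<subseteq> arr C \<and> Weq \<subseteq> arr C \<and>
     (\<forall>f \<in> arr C. \<forall>g \<in> arr C. tgt C f = src C g \<longrightarrow>
        (f \<in> Weq \<and> g \<in> Weq \<longrightarrow> g \<cdot>\<^bsub>C\<^esub> f \<in> Weq) \<and>
        (f \<in> Weq \<and> g \<cdot>\<^bsub>C\<^esub> f \<in> Weq \<longrightarrow> g \<in> Weq) \<and>
        (g \<in> Weq \<and> g \<cdot>\<^bsub>C\<^esub> f \<in> Weq \<longrightarrow> f \<in> Weq)) \<and>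
     retract_closed C CoFib \<and> retract_closed C Fib \<and> retract_closed C Weq \<and>
     (\<forall>f \<in> CoFib. \<forall>g \<in> Fib. f \<in> Weq \<or> g \<in> Weq \<longrightarrow> lifts C f g) \<and>
     (\<forall>f \<in> arr C.
        f \<in> compose_classes C Fib (CoFib \<inter> Weq) \<and>
        f \<in> compose_classes C (Fib \<inter> Weq) CoFib)"

definition fibrant_model_structure ::
    "('o, 'm, 'z) cat_scheme \<Rightarrow> 'm set \<Rightarrow> 'm set \<Rightarrow> 'm set \<Rightarrow> bool" where
  "fibrant_model_structure C CoFib Fib Weq \<longleftrightarrow>
     model_structure C CoFib Fib Weq \<and> (\<forall>X \<in> obj C. to_zero C X \<in> Fib)"

definition weak_factorization_system ::
    "('o, 'm, 'z) cat_scheme \<Rightarrow> 'm set \<Rightarrow> 'm set \<Rightarrow> bool" where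
  "weak_factorization_system C L R \<longleftrightarrow>
     L \<subseteq> arr C \<and> R \<subseteq> arr C \<and>
     retract_closed C L \<and> retract_closed C R \<and>
     (\<forall>l \<in> L. \<forall>r \<in> R. lifts C l r) \<and>
     (\<forall>f \<in> arr C. f \<in> compose_classes C R L)"

definition fibrantly_weak_factorization_system ::
    "('o, 'm, 'z) cat_scheme \<Rightarrow> 'm set \<Rightarrow> 'm set \<Rightarrow> bool" where
  "fibrantly_weak_factorization_system C L R \<longleftrightarrow>
     weak_factorization_system C L R \<and>
     (\<forall>f \<in> arr C. \<forall>g \<in> arr C. tgt C f = src C g \<longrightarrow>
        f \<in> R \<longrightarrow> g \<cdot>\<^bsub>C\<^esub> f \<in> R \<longrightarrow> g \<in> R) \<and>
     contravariantly_finite C (objs_from_zero C L \<inter> objs_to_zero C R)"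


section \<open>Weakly idempotent complete additive categories\<close>

record ('o, 'm) addcat = "('o, 'm) cat" +
  add :: "'m \<Rightarrow> 'm \<Rightarrow> 'm"  (infixl "\<oplus>\<index>" 65)
  zmor :: "'o \<Rightarrow> 'o \<Rightarrow> 'm"

definition homgroup :: "('o, 'm, 'z) addcat_scheme \<Rightarrow> 'o \<Rightarrow> 'o \<Rightarrow> 'm monoid" where
  "homgroup A X Y = \<lparr>carrier = homset A X Y, mult = add A, one = zmor A X Y\<rparr>"

definition is_biproduct ::
    "('o, 'm, 'z) addcat_scheme \<Rightarrow> 'o \<Rightarrow> 'o \<Rightarrow> 'o \<Rightarrow> 'm \<Rightarrow> 'm \<Rightarrow> 'm \<Rightarrow> 'm \<Rightarrow> bool" where
  "is_biproduct A X Y S i j p q \<longleftrightarrow> S \<in> obj A \<and>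
     i \<in> homset A X S \<and> j \<in> homset A Y S \<and> p \<in> homset A S X \<and> q \<in> homset A S Y \<and>
     p \<cdot>\<^bsub>A\<^esub> i = idm A X \<and> q \<cdot>\<^bsub>A\<^esub> j = idm A Y \<and>
     p \<cdot>\<^bsub>A\<^esub> j = zmor A Y X \<and> q \<cdot>\<^bsub>A\<^esub> i = zmor A X Y \<and>
     (i \<cdot>\<^bsub>A\<^esub> p) \<oplus>\<^bsub>A\<^esub> (j \<cdot>\<^bsub>A\<^esub> q) = idm A S"

locale additive_category = category A
  for A :: "('o, 'm, 'z) addcat_scheme" (structure) +
  assumes hom_comm_group: "\<lbrakk>X \<in> obj A; Y \<in> obj A\<rbrakk> \<Longrightarrow> comm_group (homgroup A X Y)"
    and comp_add_right: "\<lbrakk>f \<in> homset A X Y; f' \<in> homset A X Y; g \<in> homset A Y Z\<rbrakk>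
          \<Longrightarrow> g \<cdot> (f \<oplus> f') = (g \<cdot> f) \<oplus> (g \<cdot> f')"
    and comp_add_left: "\<lbrakk>f \<in> homset A X Y; g \<in> homset A Y Z; g' \<in> homset A Y Z\<rbrakk>
          \<Longrightarrow> (g \<oplus> g') \<cdot> f = (g \<cdot> f) \<oplus> (g' \<cdot> f)"
    and ex_zero_obj: "\<exists>Z. is_zero_obj A Z"
    and ex_biproduct: "\<lbrakk>X \<in> obj A; Y \<in> obj A\<rbrakk> \<Longrightarrow> \<exists>S i j p q. is_biproduct A X Y S i j p q"

definition splitting_mono :: "('o, 'm, 'z) cat_scheme \<Rightarrow> 'm \<Rightarrow> bool" where
  "splitting_mono C f \<longleftrightarrow> f \<in> arr C \<and>
     (\<exists>r \<in> homset C (tgt C f) (src C f). r \<cdot>\<^bsub>C\<^esub> f = idm C (src C f))"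

definition is_cokernel :: "('o, 'm, 'z) addcat_scheme \<Rightarrow> 'm \<Rightarrow> 'm \<Rightarrow> bool" where
  "is_cokernel A f c \<longleftrightarrow> f \<in> arr A \<and> c \<in> arr A \<and> src A c = tgt A f \<and>
     c \<cdot>\<^bsub>A\<^esub> f = zmor A (src A f) (tgt A c) \<and>
     (\<forall>Y \<in> obj A. \<forall>g \<in> homset A (tgt A f) Y. g \<cdot>\<^bsub>A\<^esub> f = zmor A (src A f) Y \<longrightarrow>
        (\<exists>!h. h \<in> homset A (tgt A c) Y \<and> h \<cdot>\<^bsub>A\<^esub> c = g))"

locale weakly_idempotent_complete_additive_category = additive_category +
  assumes splitting_mono_has_cokernel: "splitting_mono A f \<Longrightarrow> \<exists>c. is_cokernel A f c"


section \<open>The classes attached to a class of objects\<close>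

definition hom_epics :: "('o, 'm, 'z) cat_scheme \<Rightarrow> 'o set \<Rightarrow> 'm set" where
  "hom_epics C \<U> = {f \<in> arr C. hom_epic C \<U> f}"

text \<open>Cokernels are determined only up to isomorphism; \<open>Coker f \<in> \<U>\<close> is read as:
  some cokernel object of \<open>f\<close> lies in \<open>\<U>\<close>.\<close>

definition splitting_monos_coker_in ::
    "('o, 'm, 'z) addcat_scheme \<Rightarrow> 'o set \<Rightarrow> 'm set" where
  "splitting_monos_coker_in A \<U> =
     {f. splitting_mono A f \<and> (\<exists>c. is_cokernel A f c \<and> tgt A c \<in> \<U>)}"

end

theory Submission
  imports Defs
begin

text \<open>
  In a fibrant model structure every trivial cofibration \<open>A \<rightarrow> B\<close> lifts against \<open>A \<rightarrow> 0\<close>, hence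
  splits; its cokernel \<open>K\<close> satisfies \<open>0 \<rightarrow> K\<close> in \<open>TCoFib\<close>, because \<open>0 \<rightarrow> K\<close> is a retract of it. A
  split monomorphism with cokernel \<open>K\<close> lifts against \<open>g\<close> as soon as \<open>0 \<rightarrow> K\<close> does, which gives
  both descriptions in (a).

  For (b), right approximations \<open>t: U \<rightarrow> B\<close> give the factorizations
  \<open>A \<rightarrow> A \<oplus> U \<rightarrow> B\<close>, so \<open>(TCoFib, Fib)\<close> is a second weak factorization system. A retraction of
  a map in \<open>TCoFib\<close> is always in \<open>TFib\<close>. The heart of the argument is that \<open>TFib\<close> also satisfies
  right cancellation within \<open>Fib\<close>: if \<open>q\<close> and \<open>q \<cdot> p\<close> are in \<open>TFib\<close> and \<open>p\<close> is in \<open>Fib\<close>, then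
  \<open>p\<close> is in \<open>TFib\<close>. Together with the assumed left cancellation this shows that in any
  factorization \<open>q \<cdot> j\<close> of a weak equivalence with \<open>j\<close> in \<open>TCoFib\<close> and \<open>q\<close> in \<open>Fib\<close>, the map \<open>q\<close>
  is in \<open>TFib\<close>, and two out of three follows by formal manipulation of factorizations.
\<close>

section \<open>Retracts, lifting and weak factorization systems\<close>

lemma in_homset_iff: "f \<in> homset C X Y \<longleftrightarrow> f \<in> arr C \<and> src C f = X \<and> tgt C f = Y"
  by (simp add: homset_def)

context category
begin

lemma src_tgt_obj [simp]:
  assumes "f \<in> arr C"
  shows "src C f \<in> obj C" "tgt C f \<in> obj C"
  using assms src_obj tgt_obj by auto

lemma idm_arr [simp]:
  assumes "X \<in> obj C"
  shows "idm C X \<in> arr C" "src C (idm C X) = X" "tgt C (idm C X) = X"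
  using idm_hom[OF assms] by (auto simp: in_homset_iff)

lemma comp_arr [simp]:
  assumes "f \<in> arr C" "g \<in> arr C" "tgt C f = src C g"
  shows "g \<cdot> f \<in> arr C" "src C (g \<cdot> f) = src C f" "tgt C (g \<cdot> f) = tgt C g"
  using comp_hom[of f "src C f" "tgt C f" g "tgt C g"] assms by (auto simp: in_homset_iff)

lemma comp_assoc_arr [simp]:
  assumes "f \<in> arr C" "g \<in> arr C" "h \<in> arr C" "tgt C f = src C g" "tgt C g = src C h"
  shows "(h \<cdot> g) \<cdot> f = h \<cdot> (g \<cdot> f)"
  using comp_assoc[of f "src C f" "tgt C f" g "tgt C g" h "tgt C h"] assms
  by (auto simp: in_homset_iff)

lemma idm_comp [simp]:
  assumes "f \<in> arr C"
  shows "src C f = X \<Longrightarrow> f \<cdot> idm C X = f" "tgt C f = Y \<Longrightarrow> idm C Y \<cdot> f = f"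
  using idm_right[of f "src C f" "tgt C f"] idm_left[of f "src C f" "tgt C f"] assms
  by (auto simp: in_homset_iff)

text \<open>Composites are normalised to right-nested form by \<open>comp_assoc_arr\<close>, so a
  known equation for \<open>a \<cdot> b\<close> no longer matches inside a longer composite. This
  variant does.\<close>

lemma comp_eq_reassoc:
  assumes "a \<cdot> b = d" "a \<in> arr C" "b \<in> arr C" "x \<in> arr C" "tgt C b = src C a" "tgt C x = src C b"
  shows "a \<cdot> (b \<cdot> x) = d \<cdot> x"
  using assms by (simp flip: assms(1))

lemma liftsE:
  assumes "lifts C f g" "u \<in> arr C" "v \<in> arr C" "src C u = src C f" "tgt C u = src C g"
    "src C v = tgt C f" "tgt C v = tgt C g" "g \<cdot> u = v \<cdot> f"
  obtains h where "h \<in> arr C" "src C h = tgt C f" "tgt C h = src C g" "h \<cdot> f = u" "g \<cdot> h = v"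
proof -
  have "u \<in> homset C (src C f) (src C g)" "v \<in> homset C (tgt C f) (tgt C g)"
    using assms by (auto simp: in_homset_iff)
  with assms(1,8) obtain h where "h \<in> homset C (tgt C f) (src C g)" "h \<cdot> f = u" "g \<cdot> h = v"
    unfolding lifts_def by blast
  then show thesis
    using that by (auto simp: in_homset_iff)
qed

lemma liftsI:
  assumes "\<And>u v. \<lbrakk>u \<in> arr C; v \<in> arr C; src C u = src C f; tgt C u = src C g;
      src C v = tgt C f; tgt C v = tgt C g; g \<cdot> u = v \<cdot> f\<rbrakk>
    \<Longrightarrow> \<exists>h \<in> arr C. src C h = tgt C f \<and> tgt C h = src C g \<and> h \<cdot> f = u \<and> g \<cdot> h = v"
  shows "lifts C f g"
  unfolding lifts_def
proof (intro ballI impI)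
  fix u v
  assume "u \<in> homset C (src C f) (src C g)" "v \<in> homset C (tgt C f) (tgt C g)" "g \<cdot> u = v \<cdot> f"
  with assms[of u v] show "\<exists>h\<in>homset C (tgt C f) (src C g). h \<cdot> f = u \<and> g \<cdot> h = v"
    by (auto simp: homset_def)
qed

lemma retract_ofI:
  assumes "g \<in> arr C" "f \<in> arr C"
    "a \<in> arr C" "src C a = src C g" "tgt C a = src C f"
    "b \<in> arr C" "src C b = src C f" "tgt C b = src C g"
    "c \<in> arr C" "src C c = tgt C g" "tgt C c = tgt C f"
    "d \<in> arr C" "src C d = tgt C f" "tgt C d = tgt C g"
    "f \<cdot> a = c \<cdot> g" "g \<cdot> b = d \<cdot> f" "b \<cdot> a = idm C (src C g)" "d \<cdot> c = idm C (tgt C g)"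
  shows "retract_of C g f"
  unfolding retract_of_def
  by (intro conjI bexI[of _ a] bexI[of _ b] bexI[of _ c] bexI[of _ d])
    (use assms in \<open>simp_all add: in_homset_iff\<close>)

lemma retract_ofE:
  assumes "retract_of C g f"
  obtains a b c d where "g \<in> arr C" "f \<in> arr C"
    "a \<in> arr C" "src C a = src C g" "tgt C a = src C f"
    "b \<in> arr C" "src C b = src C f" "tgt C b = src C g"
    "c \<in> arr C" "src C c = tgt C g" "tgt C c = tgt C f"
    "d \<in> arr C" "src C d = tgt C f" "tgt C d = tgt C g"
    "f \<cdot> a = c \<cdot> g" "g \<cdot> b = d \<cdot> f" "b \<cdot> a = idm C (src C g)" "d \<cdot> c = idm C (tgt C g)"
proof -
  obtain a b c d where "g \<in> arr C" "f \<in> arr C"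
    "a \<in> homset C (src C g) (src C f)" "b \<in> homset C (src C f) (src C g)"
    "c \<in> homset C (tgt C g) (tgt C f)" "d \<in> homset C (tgt C f) (tgt C g)"
    "f \<cdot> a = c \<cdot> g" "g \<cdot> b = d \<cdot> f" "b \<cdot> a = idm C (src C g)" "d \<cdot> c = idm C (tgt C g)"
    using assms unfolding retract_of_def by blast
  then show thesis
    by (intro that[of a b c d]) (simp_all add: in_homset_iff)
qed

text \<open>The retract argument: lifting the square with top \<open>l\<close> and bottom an
  identity gives a section \<open>h\<close> of \<open>r\<close> with
  \<open>h \<cdot> (r \<cdot> l) = l\<close>. The pair \<open>h\<close>, \<open>r\<close> on targets
  and identities on the common source exhibit the retract.\<close>

lemma retract_of_left_factor:
  assumes "l \<in> arr C" "r \<in> arr C" "tgt C l = src C r" "lifts C (r \<cdot> l) r"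
  shows "retract_of C (r \<cdot> l) l"
proof -
  obtain h where "h \<in> arr C" "src C h = tgt C r" "tgt C h = src C r" "h \<cdot> (r \<cdot> l) = l"
    "r \<cdot> h = idm C (tgt C r)"
    by (rule liftsE[OF assms(4), of l "idm C (tgt C r)"]) (use assms in auto)
  then show ?thesis
    using assms
    by (intro retract_ofI[where a = "idm C (src C l)" and b = "idm C (src C l)" and c = h and d = r]) auto
qed

lemma retract_of_right_factor:
  assumes "l \<in> arr C" "r \<in> arr C" "tgt C l = src C r" "lifts C l (r \<cdot> l)"
  shows "retract_of C (r \<cdot> l) r"
proof -
  obtain h where "h \<in> arr C" "src C h = tgt C l" "tgt C h = src C l" "h \<cdot> l = idm C (src C l)"
    "(r \<cdot> l) \<cdot> h = r"
    by (rule liftsE[OF assms(4), of "idm C (src C l)" r]) (use assms in auto)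
  then show ?thesis
    using assms
    by (intro retract_ofI[where a = l and b = h and c = "idm C (tgt C r)" and d = "idm C (tgt C r)"]) auto
qed

lemma lifts_comp_right:
  assumes "lifts C f g" "lifts C f g'" "f \<in> arr C" "g \<in> arr C" "g' \<in> arr C" "tgt C g = src C g'"
  shows "lifts C f (g' \<cdot> g)"
proof (rule liftsI)
  fix u v
  assume uv: "u \<in> arr C" "v \<in> arr C" "src C u = src C f" "tgt C u = src C (g' \<cdot> g)"
    "src C v = tgt C f" "tgt C v = tgt C (g' \<cdot> g)" "g' \<cdot> g \<cdot> u = v \<cdot> f"
  obtain w where w: "w \<in> arr C" "src C w = tgt C f" "tgt C w = src C g'" "w \<cdot> f = g \<cdot> u" "g' \<cdot> w = v"
    by (rule liftsE[OF assms(2), of "g \<cdot> u" v]) (use assms uv in auto)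
  obtain h where "h \<in> arr C" "src C h = tgt C f" "tgt C h = src C g" "h \<cdot> f = u" "g \<cdot> h = w"
    by (rule liftsE[OF assms(1), of u w]) (use assms uv w in auto)
  then show "\<exists>h\<in>arr C. src C h = tgt C f \<and> tgt C h = src C (g' \<cdot> g) \<and> h \<cdot> f = u \<and> g' \<cdot> g \<cdot> h = v"
    using assms w by auto
qed

lemma lifts_comp_left:
  assumes "lifts C f g" "lifts C f' g" "f \<in> arr C" "f' \<in> arr C" "g \<in> arr C" "tgt C f = src C f'"
  shows "lifts C (f' \<cdot> f) g"
proof (rule liftsI)
  fix u v
  assume uv: "u \<in> arr C" "v \<in> arr C" "src C u = src C (f' \<cdot> f)" "tgt C u = src C g"
    "src C v = tgt C (f' \<cdot> f)" "tgt C v = tgt C g" "g \<cdot> u = v \<cdot> (f' \<cdot> f)"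
  obtain w where w: "w \<in> arr C" "src C w = tgt C f" "tgt C w = src C g" "w \<cdot> f = u" "g \<cdot> w = v \<cdot> f'"
    by (rule liftsE[OF assms(1), of u "v \<cdot> f'"]) (use assms uv in auto)
  obtain h where "h \<in> arr C" "src C h = tgt C f'" "tgt C h = src C g" "h \<cdot> f' = w" "g \<cdot> h = v"
    by (rule liftsE[OF assms(2), of w v]) (use assms uv w in auto)
  then show "\<exists>h\<in>arr C. src C h = tgt C (f' \<cdot> f) \<and> tgt C h = src C g \<and> h \<cdot> (f' \<cdot> f) = u \<and> g \<cdot> h = v"
    using assms w by (auto simp flip: comp_assoc_arr)
qed

lemma lifts_retract_right:
  assumes "retract_of C g f" "lifts C l f" "l \<in> arr C"
  shows "lifts C l g"
proof (rule liftsI)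
  fix u v
  assume uv: "u \<in> arr C" "v \<in> arr C" "src C u = src C l" "tgt C u = src C g"
    "src C v = tgt C l" "tgt C v = tgt C g" "g \<cdot> u = v \<cdot> l"
  obtain a b c d where r: "g \<in> arr C" "f \<in> arr C"
    "a \<in> arr C" "src C a = src C g" "tgt C a = src C f"
    "b \<in> arr C" "src C b = src C f" "tgt C b = src C g"
    "c \<in> arr C" "src C c = tgt C g" "tgt C c = tgt C f"
    "d \<in> arr C" "src C d = tgt C f" "tgt C d = tgt C g"
    and eqs: "f \<cdot> a = c \<cdot> g" "g \<cdot> b = d \<cdot> f" "b \<cdot> a = idm C (src C g)" "d \<cdot> c = idm C (tgt C g)"
    using assms(1) by (rule retract_ofE)
  obtain h where "h \<in> arr C" "src C h = tgt C l" "tgt C h = src C f" "h \<cdot> l = a \<cdot> u" "f \<cdot> h = c \<cdot> v"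
    by (rule liftsE[OF assms(2), of "a \<cdot> u" "c \<cdot> v"])
      (use assms uv r comp_eq_reassoc[OF eqs(1)] in auto)
  then show "\<exists>h\<in>arr C. src C h = tgt C l \<and> tgt C h = src C g \<and> h \<cdot> l = u \<and> g \<cdot> h = v"
    using assms uv r eqs[THEN comp_eq_reassoc] by (intro bexI[of _ "b \<cdot> h"]) auto
qed

lemma lifts_idm_left:
  assumes "X \<in> obj C" "g \<in> arr C"
  shows "lifts C (idm C X) g"
  by (rule liftsI) (use assms in auto)

lemma compose_classesE:
  assumes "f \<in> compose_classes C P I"
  obtains p i where "p \<in> P" "i \<in> I" "tgt C i = src C p" "f = p \<cdot> i"
  using assms unfolding compose_classes_def by blast

lemma compose_classesI:
  assumes "p \<in> P" "i \<in> I" "tgt C i = src C p"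
  shows "p \<cdot> i \<in> compose_classes C P I"
  using assms unfolding compose_classes_def by blast

section \<open>Weak factorization systems and their characterization by lifting\<close>

context
  fixes L R
  assumes wfs: "weak_factorization_system C L R"
begin

lemma wfs_left_arr: "f \<in> L \<Longrightarrow> f \<in> arr C"
  and wfs_right_arr: "f \<in> R \<Longrightarrow> f \<in> arr C"
  and wfs_left_retract: "f \<in> L \<Longrightarrow> retract_of C g f \<Longrightarrow> g \<in> L"
  and wfs_right_retract: "f \<in> R \<Longrightarrow> retract_of C g f \<Longrightarrow> g \<in> R"
  and wfs_lifts: "f \<in> L \<Longrightarrow> g \<in> R \<Longrightarrow> lifts C f g"
  using wfs by (auto simp: weak_factorization_system_def retract_closed_def)

lemma wfs_factorE:
  assumes "f \<in> arr C"
  obtains p i where "p \<in> R" "i \<in> L" "p \<in> arr C" "i \<in> arr C" "tgt C i = src C p" "f = p \<cdot> i"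
    "src C i = src C f" "tgt C p = tgt C f"
proof -
  have "f \<in> compose_classes C R L"
    using wfs assms unfolding weak_factorization_system_def by blast
  then obtain p i where "p \<in> R" "i \<in> L" "tgt C i = src C p" "f = p \<cdot> i"
    by (rule compose_classesE)
  then show thesis
    using that wfs_left_arr wfs_right_arr by auto
qed

text \<open>With \<open>wfs_lifts\<close> this determines \<open>L\<close> as the maps lifting
  against all of \<open>R\<close>: such an \<open>f\<close> lifts against its own right factor,
  hence is a retract of its left factor.\<close>

lemma wfs_leftI:
  assumes "f \<in> arr C" "\<And>r. r \<in> R \<Longrightarrow> lifts C f r"
  shows "f \<in> L"
proof -
  obtain p i where pi: "p \<in> R" "i \<in> L" "p \<in> arr C" "i \<in> arr C" "tgt C i = src C p" "f = p \<cdot> i"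
    using assms(1) by (rule wfs_factorE)
  then have "retract_of C f i"
    using assms(2) retract_of_left_factor by simp
  with pi show ?thesis
    using wfs_left_retract by blast
qed

lemma wfs_rightI:
  assumes "f \<in> arr C" "\<And>l. l \<in> L \<Longrightarrow> lifts C l f"
  shows "f \<in> R"
proof -
  obtain p i where pi: "p \<in> R" "i \<in> L" "p \<in> arr C" "i \<in> arr C" "tgt C i = src C p" "f = p \<cdot> i"
    using assms(1) by (rule wfs_factorE)
  then have "retract_of C f p"
    using assms(2) retract_of_right_factor by simp
  with pi show ?thesis
    using wfs_right_retract by blast
qed

lemma wfs_left_comp:
  assumes "f \<in> L" "g \<in> L" "tgt C f = src C g"
  shows "g \<cdot> f \<in> L"
proof (rule wfs_leftI)
  show "lifts C (g \<cdot> f) r" if "r \<in> R" for r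
    using assms that by (intro lifts_comp_left) (auto simp: wfs_left_arr wfs_right_arr wfs_lifts)
qed (use assms in \<open>simp add: wfs_left_arr\<close>)

lemma wfs_right_comp:
  assumes "f \<in> R" "g \<in> R" "tgt C f = src C g"
  shows "g \<cdot> f \<in> R"
proof (rule wfs_rightI)
  show "lifts C l (g \<cdot> f)" if "l \<in> L" for l
    using assms that by (intro lifts_comp_right) (auto simp: wfs_left_arr wfs_right_arr wfs_lifts)
qed (use assms in \<open>simp add: wfs_right_arr\<close>)

lemma wfs_left_idm: "X \<in> obj C \<Longrightarrow> idm C X \<in> L"
  by (rule wfs_leftI) (auto intro: lifts_idm_left dest: wfs_right_arr)

end

section \<open>The two weak factorization systems of a model structure\<close>

lemma model_structure_wfs:
  assumes "model_structure C CoFib Fib Weq"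
  shows "weak_factorization_system C CoFib (Fib \<inter> Weq)"
    and "weak_factorization_system C (CoFib \<inter> Weq) Fib"
proof -
  from assms have arrs: "CoFib \<subseteq> arr C" "Fib \<subseteq> arr C" "Weq \<subseteq> arr C"
    and retr: "retract_closed C CoFib" "retract_closed C Fib" "retract_closed C Weq"
    and lift: "\<forall>f \<in> CoFib. \<forall>g \<in> Fib. f \<in> Weq \<or> g \<in> Weq \<longrightarrow> lifts C f g"
    and fact: "\<forall>f \<in> arr C. f \<in> compose_classes C Fib (CoFib \<inter> Weq) \<and>
        f \<in> compose_classes C (Fib \<inter> Weq) CoFib"
    unfolding model_structure_def by simp_all
  have "retract_closed C (Fib \<inter> Weq)" "retract_closed C (CoFib \<inter> Weq)"
    using retr unfolding retract_closed_def by auto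
  with arrs retr lift fact show "weak_factorization_system C CoFib (Fib \<inter> Weq)"
    "weak_factorization_system C (CoFib \<inter> Weq) Fib"
    unfolding weak_factorization_system_def by auto
qed

lemma model_structure_two_of_three:
  assumes "model_structure C CoFib Fib Weq" "f \<in> arr C" "g \<in> arr C" "tgt C f = src C g"
    "g \<cdot> f \<in> Weq"
  shows "f \<in> Weq \<longleftrightarrow> g \<in> Weq"
proof -
  have "\<forall>f \<in> arr C. \<forall>g \<in> arr C. tgt C f = src C g \<longrightarrow>
      (f \<in> Weq \<and> g \<in> Weq \<longrightarrow> g \<cdot> f \<in> Weq) \<and>
      (f \<in> Weq \<and> g \<cdot> f \<in> Weq \<longrightarrow> g \<in> Weq) \<and>
      (g \<in> Weq \<and> g \<cdot> f \<in> Weq \<longrightarrow> f \<in> Weq)"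
    using assms(1) unfolding model_structure_def by (elim conjE)
  with assms(2-) show ?thesis
    by blast
qed

text \<open>Identities lift against everything and so belong to the left class
  \<open>CoFib \<inter> Weq\<close>.\<close>

lemma model_structure_idm:
  assumes "model_structure C CoFib Fib Weq" "X \<in> obj C"
  shows "idm C X \<in> Weq"
  using wfs_left_idm[OF model_structure_wfs(2)[OF assms(1)] assms(2)] by blast

end

section \<open>Additive categories\<close>

context additive_category
begin

lemma add_arr [simp]:
  assumes "f \<in> arr A" "g \<in> arr A" "src A f = src A g" "tgt A f = tgt A g"
  shows "f \<oplus> g \<in> arr A" "src A (f \<oplus> g) = src A g" "tgt A (f \<oplus> g) = tgt A g"
proof -
  interpret comm_group "homgroup A (src A g) (tgt A g)"
    using assms by (intro hom_comm_group) auto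
  have "f \<oplus> g \<in> homset A (src A g) (tgt A g)"
    using m_closed[of f g] assms by (simp add: homgroup_def in_homset_iff)
  then show "f \<oplus> g \<in> arr A" "src A (f \<oplus> g) = src A g" "tgt A (f \<oplus> g) = tgt A g"
    by (auto simp: in_homset_iff)
qed

lemma zmor_arr [simp]:
  assumes "X \<in> obj A" "Y \<in> obj A"
  shows "zmor A X Y \<in> arr A" "src A (zmor A X Y) = X" "tgt A (zmor A X Y) = Y"
proof -
  interpret comm_group "homgroup A X Y"
    using assms by (rule hom_comm_group)
  have "zmor A X Y \<in> homset A X Y"
    using one_closed by (simp add: homgroup_def)
  then show "zmor A X Y \<in> arr A" "src A (zmor A X Y) = X" "tgt A (zmor A X Y) = Y"
    by (auto simp: in_homset_iff)
qed

lemma add_zmor [simp]: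
  assumes "f \<in> arr A" "src A f = X" "tgt A f = Y"
  shows "f \<oplus> zmor A X Y = f" "zmor A X Y \<oplus> f = f"
proof -
  interpret comm_group "homgroup A X Y"
    using assms by (intro hom_comm_group) auto
  show "f \<oplus> zmor A X Y = f" "zmor A X Y \<oplus> f = f"
    using r_one[of f] l_one[of f] assms by (simp_all add: homgroup_def in_homset_iff)
qed

lemma add_left_imp_zmor:
  assumes "f \<in> arr A" "g \<in> arr A" "src A g = src A f" "tgt A g = tgt A f" "f \<oplus> g = f"
  shows "g = zmor A (src A f) (tgt A f)"
proof -
  interpret comm_group "homgroup A (src A f) (tgt A f)"
    using assms by (intro hom_comm_group) auto
  show ?thesis
    using l_cancel_one[of f g] assms by (simp add: homgroup_def in_homset_iff)
qed

text \<open>Subtraction: \<open>d\<close> is \<open>g - f\<close>, formed in the hom group.\<close>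

lemma ex_difference:
  assumes "f \<in> arr A" "g \<in> arr A" "src A g = src A f" "tgt A g = tgt A f"
  obtains d where "d \<in> arr A" "src A d = src A f" "tgt A d = tgt A f" "f \<oplus> d = g"
proof -
  let ?G = "homgroup A (src A f) (tgt A f)"
  interpret comm_group ?G
    using assms by (intro hom_comm_group) auto
  have fg: "f \<in> carrier ?G" "g \<in> carrier ?G"
    using assms by (auto simp: homgroup_def in_homset_iff)
  then have "f \<otimes>\<^bsub>?G\<^esub> (inv\<^bsub>?G\<^esub> f \<otimes>\<^bsub>?G\<^esub> g) = g" "inv\<^bsub>?G\<^esub> f \<otimes>\<^bsub>?G\<^esub> g \<in> carrier ?G"
    by (simp_all add: m_assoc[symmetric])
  then show thesis
    by (intro that[of "inv\<^bsub>?G\<^esub> f \<otimes>\<^bsub>?G\<^esub> g"]) (simp_all add: homgroup_def in_homset_iff)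
qed

lemma comp_add [simp]:
  assumes "f \<in> arr A" "f' \<in> arr A" "g \<in> arr A" "src A f' = src A f" "tgt A f' = tgt A f"
  shows "tgt A f = src A g \<Longrightarrow> g \<cdot> (f \<oplus> f') = (g \<cdot> f) \<oplus> (g \<cdot> f')"
    and "src A f = tgt A g \<Longrightarrow> (f \<oplus> f') \<cdot> g = (f \<cdot> g) \<oplus> (f' \<cdot> g)"
  using assms comp_add_right[of f "src A f" "tgt A f" f' g "tgt A g"]
    comp_add_left[of g "src A g" "tgt A g" f "tgt A f" f']
  by (auto simp: in_homset_iff)

text \<open>By distributivity the composite \<open>x\<close> satisfies
  \<open>x \<oplus> x = x\<close>, which forces it to be zero.\<close>

lemma comp_zmor [simp]:
  assumes "g \<in> arr A"
  shows "\<lbrakk>src A g = Y; X \<in> obj A\<rbrakk> \<Longrightarrow> g \<cdot> zmor A X Y = zmor A X (tgt A g)"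
    and "\<lbrakk>tgt A g = X; Y \<in> obj A\<rbrakk> \<Longrightarrow> zmor A X Y \<cdot> g = zmor A (src A g) Y"
proof -
  assume Y: "src A g = Y" "X \<in> obj A"
  then have "Y \<in> obj A"
    using assms by auto
  then have "g \<cdot> zmor A X Y \<oplus> g \<cdot> zmor A X Y = g \<cdot> zmor A X Y"
    using assms Y by (simp flip: comp_add)
  then show "g \<cdot> zmor A X Y = zmor A X (tgt A g)"
    using add_left_imp_zmor[of "g \<cdot> zmor A X Y" "g \<cdot> zmor A X Y"] assms Y \<open>Y \<in> obj A\<close> by simp
next
  assume X: "tgt A g = X" "Y \<in> obj A"
  then have "X \<in> obj A"
    using assms by auto
  then have "zmor A X Y \<cdot> g \<oplus> zmor A X Y \<cdot> g = zmor A X Y \<cdot> g"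
    using assms X by (simp flip: comp_add(2))
  then show "zmor A X Y \<cdot> g = zmor A (src A g) Y"
    using add_left_imp_zmor[of "zmor A X Y \<cdot> g" "zmor A X Y \<cdot> g"] assms X \<open>X \<in> obj A\<close> by simp
qed

section \<open>Maps into and out of the zero object\<close>

lemma zero_obj_is_zero: "is_zero_obj A (zero_obj A)"
  unfolding zero_obj_def using ex_zero_obj by (rule someI_ex)

lemma zero_obj_obj [simp]: "zero_obj A \<in> obj A"
  using zero_obj_is_zero by (simp add: is_zero_obj_def)

lemma from_zero_unique:
  assumes "f \<in> arr A" "src A f = zero_obj A" "tgt A f = X"
  shows "f = from_zero A X"
proof -
  have "X \<in> obj A"
    using assms by auto
  then have "\<exists>!f. f \<in> homset A (zero_obj A) X"
    using zero_obj_is_zero by (simp add: is_zero_obj_def)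
  from the1_equality[OF this, of f] show ?thesis
    using assms by (simp add: from_zero_def in_homset_iff)
qed

lemma to_zero_unique:
  assumes "f \<in> arr A" "tgt A f = zero_obj A" "src A f = X"
  shows "f = to_zero A X"
proof -
  have "X \<in> obj A"
    using assms by auto
  then have "\<exists>!f. f \<in> homset A X (zero_obj A)"
    using zero_obj_is_zero by (simp add: is_zero_obj_def)
  from the1_equality[OF this, of f] show ?thesis
    using assms by (simp add: to_zero_def in_homset_iff)
qed

lemma from_zero_ext:
  assumes "f \<in> arr A" "g \<in> arr A" "src A f = zero_obj A" "src A g = zero_obj A" "tgt A f = tgt A g"
  shows "f = g"
  using from_zero_unique[of f] from_zero_unique[of g] assms by simp

lemma from_zero_eq_zmor: "X \<in> obj A \<Longrightarrow> from_zero A X = zmor A (zero_obj A) X"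
  by (rule from_zero_unique[symmetric]) auto

lemma to_zero_eq_zmor: "X \<in> obj A \<Longrightarrow> to_zero A X = zmor A X (zero_obj A)"
  by (rule to_zero_unique[symmetric]) auto

lemma from_zero_arr [simp]:
  assumes "X \<in> obj A"
  shows "from_zero A X \<in> arr A" "src A (from_zero A X) = zero_obj A" "tgt A (from_zero A X) = X"
  using assms by (simp_all add: from_zero_eq_zmor)

lemma to_zero_arr [simp]:
  assumes "X \<in> obj A"
  shows "to_zero A X \<in> arr A" "tgt A (to_zero A X) = zero_obj A" "src A (to_zero A X) = X"
  using assms by (simp_all add: to_zero_eq_zmor)

text \<open>The top edge of a square starting at 0 is unique and the upper triangle commutes
  automatically, so lifting only asks that the bottom edge factor through \<open>g\<close>.\<close>

lemma lifts_from_zeroI: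
  assumes "X \<in> obj A" "g \<in> arr A"
    and "\<And>v. \<lbrakk>v \<in> arr A; src A v = X; tgt A v = tgt A g\<rbrakk>
      \<Longrightarrow> \<exists>h \<in> arr A. src A h = X \<and> tgt A h = src A g \<and> g \<cdot> h = v"
  shows "lifts A (from_zero A X) g"
proof (rule liftsI)
  fix u v
  assume "u \<in> arr A" "v \<in> arr A" "src A u = src A (from_zero A X)" "tgt A u = src A g"
    "src A v = tgt A (from_zero A X)" "tgt A v = tgt A g"
  then have v: "v \<in> arr A" "src A v = X" "tgt A v = tgt A g"
    and u: "u = from_zero A (src A g)"
    using assms(1) by (auto intro: from_zero_unique)
  obtain h where "h \<in> arr A" "src A h = X" "tgt A h = src A g" "g \<cdot> h = v"
    using assms(3)[OF v] by blast
  then show "\<exists>h\<in>arr A. src A h = tgt A (from_zero A X) \<and> tgt A h = src A g \<and>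
      h \<cdot> from_zero A X = u \<and> g \<cdot> h = v"
    using assms(1,2) u by (intro bexI[of _ h]) (auto simp: from_zero_eq_zmor)
qed

lemma lifts_from_zeroE:
  assumes "lifts A (from_zero A X) g" "g \<in> arr A" "v \<in> arr A" "src A v = X" "tgt A v = tgt A g"
  obtains h where "h \<in> arr A" "src A h = X" "tgt A h = src A g" "g \<cdot> h = v"
proof -
  have "X \<in> obj A"
    using assms by auto
  obtain h where "h \<in> arr A" "src A h = tgt A (from_zero A X)" "tgt A h = src A g" "g \<cdot> h = v"
    by (rule liftsE[OF assms(1), of "from_zero A (src A g)" v])
      (use assms \<open>X \<in> obj A\<close> in \<open>auto simp: from_zero_eq_zmor\<close>)
  then show thesis
    using \<open>X \<in> obj A\<close> by (intro that[of h]) auto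
qed

lemma lifts_to_zeroE:
  assumes "lifts A g (to_zero A X)" "g \<in> arr A" "u \<in> arr A" "tgt A u = X" "src A u = src A g"
  obtains h where "h \<in> arr A" "src A h = tgt A g" "tgt A h = X" "h \<cdot> g = u"
proof -
  have "X \<in> obj A"
    using assms by auto
  obtain h where "h \<in> arr A" "src A h = tgt A g" "tgt A h = src A (to_zero A X)" "h \<cdot> g = u"
    by (rule liftsE[OF assms(1), of u "to_zero A (tgt A g)"])
      (use assms \<open>X \<in> obj A\<close> in \<open>auto simp: to_zero_eq_zmor\<close>)
  then show thesis
    using \<open>X \<in> obj A\<close> by (intro that[of h]) auto
qed

text \<open>Surjectivity of Hom(U, g) is the lifting property of 0 -> U against \<open>g\<close>. In
  this form the class is accessible to the calculus of lifting and retracts.\<close>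

lemma mem_hom_epics_iff:
  assumes "\<U> \<subseteq> obj A"
  shows "g \<in> hom_epics A \<U> \<longleftrightarrow> g \<in> arr A \<and> (\<forall>U\<in>\<U>. lifts A (from_zero A U) g)"
proof (intro iffI conjI ballI)
  fix U
  assume g: "g \<in> hom_epics A \<U>" and U: "U \<in> \<U>"
  then show "lifts A (from_zero A U) g"
  proof (intro lifts_from_zeroI)
    fix v
    assume "v \<in> arr A" "src A v = U" "tgt A v = tgt A g"
    then have "v \<in> (\<lambda>h. g \<cdot> h) ` homset A U (src A g)"
      using g U by (auto simp: hom_epics_def hom_epic_def in_homset_iff)
    then show "\<exists>h\<in>arr A. src A h = U \<and> tgt A h = src A g \<and> g \<cdot> h = v"
      by (auto simp: in_homset_iff)
  qed (use assms in \<open>auto simp: hom_epics_def\<close>)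
next
  assume g: "g \<in> arr A \<and> (\<forall>U\<in>\<U>. lifts A (from_zero A U) g)"
  have "(\<lambda>h. g \<cdot> h) ` homset A U (src A g) = homset A U (tgt A g)" if "U \<in> \<U>" for U
  proof (intro equalityI subsetI)
    fix v
    assume "v \<in> homset A U (tgt A g)"
    then have v: "v \<in> arr A" "src A v = U" "tgt A v = tgt A g"
      by (auto simp: in_homset_iff)
    obtain h where "h \<in> arr A" "src A h = U" "tgt A h = src A g" "g \<cdot> h = v"
      by (rule lifts_from_zeroE[of U g v]) (use g \<open>U \<in> \<U>\<close> v in simp_all)
    then show "v \<in> (\<lambda>h. g \<cdot> h) ` homset A U (src A g)"
      by (auto simp: in_homset_iff)
  qed (use g in \<open>auto simp: in_homset_iff\<close>)
  with g show "g \<in> hom_epics A \<U>"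
    by (simp add: hom_epics_def hom_epic_def)
qed (simp add: hom_epics_def)


section \<open>Biproducts and splitting monomorphisms\<close>

context
  fixes X Y S i j p q
  assumes bip: "is_biproduct A X Y S i j p q"
begin

lemma biproduct_arr:
  "S \<in> obj A" "X \<in> obj A" "Y \<in> obj A"
  "i \<in> arr A" "src A i = X" "tgt A i = S"
  "j \<in> arr A" "src A j = Y" "tgt A j = S"
  "p \<in> arr A" "src A p = S" "tgt A p = X"
  "q \<in> arr A" "src A q = S" "tgt A q = Y"
  using bip by (auto simp: is_biproduct_def in_homset_iff)

lemma biproduct_eqs:
  "p \<cdot> i = idm A X" "q \<cdot> j = idm A Y" "p \<cdot> j = zmor A Y X" "q \<cdot> i = zmor A X Y"
  "(i \<cdot> p) \<oplus> (j \<cdot> q) = idm A S"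
  using bip by (auto simp: is_biproduct_def)

lemmas biproduct_simps = biproduct_arr biproduct_eqs(1-4) biproduct_eqs(1-4)[THEN comp_eq_reassoc]

lemma biproduct_ext_right:
  assumes "f \<in> arr A" "tgt A f = S"
  shows "f = (i \<cdot> (p \<cdot> f)) \<oplus> (j \<cdot> (q \<cdot> f))"
proof -
  have "f = ((i \<cdot> p) \<oplus> (j \<cdot> q)) \<cdot> f"
    unfolding biproduct_eqs using assms by simp
  then show ?thesis
    using assms by (simp add: biproduct_arr)
qed

lemma biproduct_ext_left:
  assumes "f \<in> arr A" "src A f = S"
  shows "f = ((f \<cdot> i) \<cdot> p) \<oplus> ((f \<cdot> j) \<cdot> q)"
proof -
  have "f = f \<cdot> ((i \<cdot> p) \<oplus> (j \<cdot> q))"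
    unfolding biproduct_eqs using assms by simp
  then show ?thesis
    using assms by (simp add: biproduct_arr)
qed

lemma biproduct_injection_splitting_mono: "splitting_mono A i"
  unfolding splitting_mono_def
  using biproduct_simps by (auto intro!: bexI[of _ p] simp: in_homset_iff)

lemma biproduct_injection_cokernel: "is_cokernel A i q"
  unfolding is_cokernel_def
proof (intro conjI ballI impI)
  fix Z g
  assume "g \<in> homset A (tgt A i) Z" "g \<cdot> i = zmor A (src A i) Z"
  then have g: "g \<in> arr A" "src A g = S" "tgt A g = Z" "g \<cdot> i = zmor A X Z" "Z \<in> obj A"
    by (auto simp: in_homset_iff biproduct_simps)
  show "\<exists>!h. h \<in> homset A (tgt A q) Z \<and> h \<cdot> q = g"
  proof (rule ex1I[of _ "g \<cdot> j"])
    show "g \<cdot> j \<in> homset A (tgt A q) Z \<and> (g \<cdot> j) \<cdot> q = g"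
      using biproduct_ext_left[OF g(1,2)] g by (simp add: in_homset_iff biproduct_simps)
    show "h = g \<cdot> j" if "h \<in> homset A (tgt A q) Z \<and> h \<cdot> q = g" for h
      using that by (auto simp: in_homset_iff biproduct_simps)
  qed
qed (auto simp: biproduct_simps)

text \<open>A diagonal out of \<open>S\<close> is a pair of maps out of \<open>X\<close> and
  \<open>Y\<close>. The first must be \<open>u\<close>; the second is any lift \<open>w\<close> of
  \<open>v \<cdot> j\<close> through \<open>g\<close>.\<close>

lemma lifts_biproduct_injection:
  assumes "lifts A (from_zero A Y) g" "g \<in> arr A"
  shows "lifts A i g"
proof (rule liftsI)
  fix u v
  assume "u \<in> arr A" "v \<in> arr A" "src A u = src A i" "tgt A u = src A g"
    "src A v = tgt A i" "tgt A v = tgt A g" "g \<cdot> u = v \<cdot> i"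
  then have uv: "u \<in> arr A" "v \<in> arr A" "src A u = X" "tgt A u = src A g"
    "src A v = S" "tgt A v = tgt A g" "g \<cdot> u = v \<cdot> i"
    by (auto simp: biproduct_simps)
  obtain w where w: "w \<in> arr A" "src A w = Y" "tgt A w = src A g" "g \<cdot> w = v \<cdot> j"
    by (rule lifts_from_zeroE[OF assms, of "v \<cdot> j"]) (use uv in \<open>auto simp: biproduct_simps\<close>)
  have "g \<cdot> ((u \<cdot> p) \<oplus> (w \<cdot> q)) = v"
    using biproduct_ext_left[of v] assms(2) uv w
    by (simp add: biproduct_simps comp_eq_reassoc[OF uv(7)] comp_eq_reassoc[OF w(4)])
  then show "\<exists>h\<in>arr A. src A h = tgt A i \<and> tgt A h = src A g \<and> h \<cdot> i = u \<and> g \<cdot> h = v"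
    using assms(2) uv w by (intro bexI[of _ "(u \<cdot> p) \<oplus> (w \<cdot> q)"]) (auto simp: biproduct_simps)
qed

text \<open>Dually, a diagonal into \<open>S\<close> has first component \<open>v\<close>, and its
  second component extends \<open>q \<cdot> u\<close> along \<open>g\<close>.\<close>

lemma lifts_biproduct_projection:
  assumes "lifts A g (to_zero A Y)" "g \<in> arr A"
  shows "lifts A g p"
proof (rule liftsI)
  fix u v
  assume "u \<in> arr A" "v \<in> arr A" "src A u = src A g" "tgt A u = src A p"
    "src A v = tgt A g" "tgt A v = tgt A p" "p \<cdot> u = v \<cdot> g"
  then have uv: "u \<in> arr A" "v \<in> arr A" "src A u = src A g" "tgt A u = S"
    "src A v = tgt A g" "tgt A v = X" "p \<cdot> u = v \<cdot> g"
    by (auto simp: biproduct_simps)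
  obtain w where w: "w \<in> arr A" "src A w = tgt A g" "tgt A w = Y" "w \<cdot> g = q \<cdot> u"
    by (rule lifts_to_zeroE[OF assms, of "q \<cdot> u"]) (use uv in \<open>auto simp: biproduct_simps\<close>)
  have "((i \<cdot> v) \<oplus> (j \<cdot> w)) \<cdot> g = u"
    using biproduct_ext_right[of u] assms(2) uv w by (simp add: biproduct_simps)
  then show "\<exists>h\<in>arr A. src A h = tgt A g \<and> tgt A h = src A p \<and> h \<cdot> g = u \<and> p \<cdot> h = v"
    using assms(2) uv w by (intro bexI[of _ "(i \<cdot> v) \<oplus> (j \<cdot> w)"]) (auto simp: biproduct_simps)
qed

text \<open>The sources retract through the zero maps between 0 and \<open>X\<close>, the targets
  through \<open>j\<close> and \<open>q\<close>. This moves membership in a left class from a split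
  monomorphism to its cokernel.\<close>

lemma from_zero_retract_biproduct_injection: "retract_of A (from_zero A Y) i"
proof -
  have "i \<cdot> from_zero A X = j \<cdot> from_zero A Y" "idm A (zero_obj A) = to_zero A X \<cdot> from_zero A X"
    "from_zero A Y \<cdot> to_zero A X = q \<cdot> i"
    by (auto intro: from_zero_ext simp: biproduct_simps from_zero_eq_zmor to_zero_eq_zmor)
  then show ?thesis
    by (intro retract_ofI[where a = "from_zero A X" and b = "to_zero A X" and c = j and d = q])
      (auto simp: biproduct_simps)
qed

end

section \<open>Cokernels and complements of split monomorphisms\<close>

lemma cokernel_arr:
  assumes "is_cokernel A f c"
  shows "f \<in> arr A" "c \<in> arr A" "src A c = tgt A f" "c \<cdot> f = zmor A (src A f) (tgt A c)"
  using assms by (auto simp: is_cokernel_def)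

lemma cokernel_factorE:
  assumes "is_cokernel A f c" "g \<in> arr A" "src A g = tgt A f" "g \<cdot> f = zmor A (src A f) (tgt A g)"
  obtains h where "h \<in> arr A" "src A h = tgt A c" "tgt A h = tgt A g" "h \<cdot> c = g"
proof -
  have "\<exists>!h. h \<in> homset A (tgt A c) (tgt A g) \<and> h \<cdot> c = g"
    using assms unfolding is_cokernel_def by (auto simp: in_homset_iff)
  then show thesis
    using that by (auto simp: in_homset_iff)
qed

lemma cokernel_cancel:
  assumes "is_cokernel A f c" "h \<in> arr A" "h' \<in> arr A" "src A h = tgt A c" "src A h' = tgt A c"
    "tgt A h = tgt A h'" "h \<cdot> c = h' \<cdot> c"
  shows "h = h'"
proof -
  note c = cokernel_arr[OF assms(1)]
  have "h \<cdot> c \<in> homset A (tgt A f) (tgt A h)" "(h \<cdot> c) \<cdot> f = zmor A (src A f) (tgt A h)"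
    using c assms by (auto simp: in_homset_iff)
  then have "\<exists>!k. k \<in> homset A (tgt A c) (tgt A h) \<and> k \<cdot> c = h \<cdot> c"
    using assms(1,2) unfolding is_cokernel_def by auto
  moreover have "h \<in> homset A (tgt A c) (tgt A h)" "h' \<in> homset A (tgt A c) (tgt A h)"
    using assms by (auto simp: in_homset_iff)
  ultimately show ?thesis
    using assms(7) by auto
qed

text \<open>The map \<open>d = 1 - f \<cdot> r\<close> kills \<open>f\<close>, so it factors as
  \<open>s \<cdot> c\<close>, and \<open>s\<close> is the second injection. The identities for
  \<open>s\<close> are checked after composing with the epimorphism \<open>c\<close>. The given
  \<open>r\<close> is kept as the projection, since later arguments concern particular
  retractions.\<close>

lemma retraction_biproduct:
  assumes c: "is_cokernel A f c" and r: "r \<in> arr A" "src A r = tgt A f" "tgt A r = src A f"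
    and rf: "r \<cdot> f = idm A (src A f)"
  obtains s where "is_biproduct A (src A f) (tgt A c) (tgt A f) f s r c"
proof -
  note c' = cokernel_arr[OF c]
  have f: "f \<in> arr A"
    using c' by simp
  obtain d where d: "d \<in> arr A" "src A d = tgt A f" "tgt A d = tgt A f"
    and frd: "(f \<cdot> r) \<oplus> d = idm A (tgt A f)"
    by (rule ex_difference[of "f \<cdot> r" "idm A (tgt A f)"]) (use f r in auto)
  have "((f \<cdot> r) \<oplus> d) \<cdot> f = f"
    unfolding frd using f by simp
  then have "f \<oplus> (d \<cdot> f) = f"
    using f r d rf by simp
  then have df: "d \<cdot> f = zmor A (src A f) (tgt A f)"
    using add_left_imp_zmor[of f "d \<cdot> f"] f d by simp
  obtain s where s: "s \<in> arr A" "src A s = tgt A c" "tgt A s = tgt A f" "s \<cdot> c = d"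
    by (rule cokernel_factorE[OF c, of d]) (use d df in auto)
  have "c \<cdot> ((f \<cdot> r) \<oplus> d) = c"
    unfolding frd using c' by simp
  then have "c \<cdot> d = c"
    using c' r d by (simp add: comp_eq_reassoc[OF c'(4)])
  then have "(c \<cdot> s) \<cdot> c = idm A (tgt A c) \<cdot> c"
    using s c' by simp
  then have cs: "c \<cdot> s = idm A (tgt A c)"
    using s c' by (intro cokernel_cancel[OF c, of "c \<cdot> s"]) simp_all
  have "r \<cdot> ((f \<cdot> r) \<oplus> d) = r"
    unfolding frd using r f by simp
  then have "r \<oplus> (r \<cdot> d) = r"
    using c' r d by (simp add: comp_eq_reassoc[OF rf])
  then have "r \<cdot> d = zmor A (tgt A f) (src A f)"
    using add_left_imp_zmor[of r "r \<cdot> d"] r d by simp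
  then have "(r \<cdot> s) \<cdot> c = zmor A (tgt A c) (src A f) \<cdot> c"
    using s c' r by simp
  then have rs: "r \<cdot> s = zmor A (tgt A c) (src A f)"
    using s c' r by (intro cokernel_cancel[OF c, of "r \<cdot> s"]) simp_all
  show thesis
    using c' r s frd rf cs rs by (intro that[of s]) (auto simp: is_biproduct_def in_homset_iff)
qed

lemma splitting_mono_biproduct:
  assumes "splitting_mono A f" "is_cokernel A f c"
  obtains s r where "is_biproduct A (src A f) (tgt A c) (tgt A f) f s r c"
proof -
  obtain r where "r \<in> arr A" "src A r = tgt A f" "tgt A r = src A f" "r \<cdot> f = idm A (src A f)"
    using assms(1) unfolding splitting_mono_def by (auto simp: in_homset_iff)
  then show thesis
    using that retraction_biproduct[OF assms(2)] by blast
qed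

lemma splitting_monos_coker_inE:
  assumes "f \<in> splitting_monos_coker_in A \<U>"
  obtains c s r where "tgt A c \<in> \<U>" "is_biproduct A (src A f) (tgt A c) (tgt A f) f s r c"
  using assms splitting_mono_biproduct unfolding splitting_monos_coker_in_def by blast

lemma biproduct_injection_coker_in:
  assumes "is_biproduct A X Y S i j p q" "Y \<in> \<U>"
  shows "i \<in> splitting_monos_coker_in A \<U>"
  using biproduct_injection_splitting_mono[OF assms(1)] biproduct_injection_cokernel[OF assms(1)]
    biproduct_arr[OF assms(1)] assms(2)
  unfolding splitting_monos_coker_in_def by auto

lemma splitting_mono_coker_lifts:
  assumes "f \<in> splitting_monos_coker_in A \<U>" "g \<in> arr A"
    and "\<And>U. U \<in> \<U> \<Longrightarrow> lifts A (from_zero A U) g"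
  shows "lifts A f g"
  using assms by (elim splitting_monos_coker_inE) (blast intro: lifts_biproduct_injection)

text \<open>A direct summand of the source on which \<open>f\<close> vanishes splits off: sources
  retract by \<open>s\<close> and \<open>c\<close>, targets through 0. It is used to show that
  complements of split monomorphisms are in \<open>objs_to_zero A TFib\<close>.\<close>

lemma to_zero_retract:
  assumes "f \<in> arr A" "s \<in> arr A" "c \<in> arr A" "tgt A s = src A f" "src A c = src A f"
    "tgt A c = src A s" "c \<cdot> s = idm A (src A s)" "f \<cdot> s = zmor A (src A s) (tgt A f)"
  shows "retract_of A (to_zero A (src A s)) f"
proof -
  have "to_zero A (src A s) \<cdot> c = to_zero A (tgt A f) \<cdot> f"
    "to_zero A (tgt A f) \<cdot> from_zero A (tgt A f) = idm A (zero_obj A)"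
    "f \<cdot> s = from_zero A (tgt A f) \<cdot> to_zero A (src A s)"
    using assms by (auto intro: from_zero_ext simp: from_zero_eq_zmor to_zero_eq_zmor)
  then show ?thesis
    using assms
    by (intro retract_ofI[where a = s and b = c and c = "from_zero A (tgt A f)"
          and d = "to_zero A (tgt A f)"]) auto
qed

end

context weakly_idempotent_complete_additive_category
begin

text \<open>Weak idempotent completeness enters here: it provides the cokernel that serves as the
  complement.\<close>

lemma retraction_biproductE:
  assumes "f \<in> arr A" "r \<in> arr A" "src A r = tgt A f" "tgt A r = src A f"
    "r \<cdot> f = idm A (src A f)"
  obtains K s c where "is_biproduct A (src A f) K (tgt A f) f s r c"
proof -
  have "splitting_mono A f"
    using assms by (auto simp: splitting_mono_def in_homset_iff)
  then obtain c where "is_cokernel A f c"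
    using splitting_mono_has_cokernel by blast
  then show thesis
    using retraction_biproduct assms that by blast
qed


section \<open>From fibrant model structures to fibrantly weak factorization systems\<close>

context
  fixes CoFib Fib Weq
  assumes fibrant_model: "fibrant_model_structure A CoFib Fib Weq"
begin

abbreviation (input) model_TC where
  "model_TC \<equiv> objs_from_zero A CoFib \<inter> objs_to_zero A (Fib \<inter> Weq)"

lemma fibrant_model_model: "model_structure A CoFib Fib Weq"
  using fibrant_model by (simp add: fibrant_model_structure_def)

lemmas model_wfs = model_structure_wfs[OF fibrant_model_model]

lemma model_to_zero_fib: "X \<in> obj A \<Longrightarrow> to_zero A X \<in> Fib"
  using fibrant_model by (simp add: fibrant_model_structure_def)

text \<open>The composite 0 -> X -> 0 is an identity, so by two out of three one factor is a weak
  equivalence if and only if the other is; X -> 0 is always a fibration.\<close>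

lemma model_TC_iff: "X \<in> model_TC \<longleftrightarrow> X \<in> obj A \<and> from_zero A X \<in> CoFib \<inter> Weq"
proof (cases "X \<in> obj A")
  case True
  then have "to_zero A X \<cdot> from_zero A X = idm A (zero_obj A)"
    by (intro from_zero_ext) auto
  then have "to_zero A X \<cdot> from_zero A X \<in> Weq"
    using model_structure_idm[OF fibrant_model_model] by simp
  then have "from_zero A X \<in> Weq \<longleftrightarrow> to_zero A X \<in> Weq"
    using True by (intro model_structure_two_of_three[OF fibrant_model_model]) auto
  then show ?thesis
    using True model_to_zero_fib by (auto simp: objs_from_zero_def objs_to_zero_def)
qed (simp add: objs_from_zero_def)

lemma model_tcofib_eq: "CoFib \<inter> Weq = splitting_monos_coker_in A model_TC"
proof (intro equalityI subsetI)
  fix i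
  assume i: "i \<in> CoFib \<inter> Weq"
  note i_arr = wfs_left_arr[OF model_wfs(2) i]
  have lift: "lifts A i (to_zero A (src A i))"
    using wfs_lifts[OF model_wfs(2) i] model_to_zero_fib i_arr by simp
  obtain r where r: "r \<in> arr A" "src A r = tgt A i" "tgt A r = src A i" "r \<cdot> i = idm A (src A i)"
    by (rule lifts_to_zeroE[OF lift, of "idm A (src A i)"]) (use i_arr in auto)
  obtain K s c where bip: "is_biproduct A (src A i) K (tgt A i) i s r c"
    using retraction_biproductE[OF i_arr r] by blast
  have "from_zero A K \<in> CoFib \<inter> Weq"
    using wfs_left_retract[OF model_wfs(2) i from_zero_retract_biproduct_injection[OF bip]] .
  then have "K \<in> model_TC"
    using model_TC_iff biproduct_arr[OF bip] by blast
  with bip show "i \<in> splitting_monos_coker_in A model_TC"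
    by (rule biproduct_injection_coker_in)
next
  fix i
  assume i: "i \<in> splitting_monos_coker_in A model_TC"
  show "i \<in> CoFib \<inter> Weq"
  proof (rule wfs_leftI[OF model_wfs(2)])
    show "i \<in> arr A"
      using i by (simp add: splitting_monos_coker_in_def splitting_mono_def)
    show "lifts A i g" if "g \<in> Fib" for g
    proof (rule splitting_mono_coker_lifts[OF i])
      show "g \<in> arr A"
        using wfs_right_arr[OF model_wfs(2) that] .
      show "lifts A (from_zero A U) g" if "U \<in> model_TC" for U
        using wfs_lifts[OF model_wfs(2) _ \<open>g \<in> Fib\<close>] that model_TC_iff by blast
    qed
  qed
qed

text \<open>\<open>Fib\<close> is determined by lifting against \<open>CoFib \<inter> Weq\<close>,
  and by \<open>model_tcofib_eq\<close> this reduces to lifting against the maps 0 -> U with U in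
  \<open>model_TC\<close>.\<close>

lemma model_fib_eq: "Fib = hom_epics A model_TC"
proof (intro equalityI subsetI)
  have TC: "model_TC \<subseteq> obj A"
    using model_TC_iff by blast
  show "g \<in> hom_epics A model_TC" if "g \<in> Fib" for g
    using that model_TC_iff wfs_right_arr[OF model_wfs(2) that] wfs_lifts[OF model_wfs(2) _ that]
    by (simp add: mem_hom_epics_iff[OF TC])
  show "g \<in> Fib" if "g \<in> hom_epics A model_TC" for g
  proof (rule wfs_rightI[OF model_wfs(2)])
    have g: "g \<in> arr A" "\<And>U. U \<in> model_TC \<Longrightarrow> lifts A (from_zero A U) g"
      using that mem_hom_epics_iff[OF TC] by blast+
    then show "g \<in> arr A"
      by simp
    show "lifts A i g" if "i \<in> CoFib \<inter> Weq" for i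
      using that g splitting_mono_coker_lifts unfolding model_tcofib_eq by blast
  qed
qed

text \<open>Factor 0 -> B as a trivial cofibration followed by a fibration \<open>t\<close>. The
  middle object is in \<open>model_TC\<close>, and \<open>t\<close> is an approximation because 0 ->
  U lifts against it.\<close>

lemma model_TC_contravariantly_finite: "contravariantly_finite A model_TC"
  unfolding contravariantly_finite_def
proof
  fix B
  assume B: "B \<in> obj A"
  obtain t i where t: "t \<in> Fib" "i \<in> CoFib \<inter> Weq" "t \<in> arr A" "i \<in> arr A"
    "tgt A i = src A t" "from_zero A B = t \<cdot> i" "src A i = src A (from_zero A B)"
    "tgt A t = tgt A (from_zero A B)"
    by (rule wfs_factorE[OF model_wfs(2), of "from_zero A B"]) (use B in auto)
  have "src A i = zero_obj A" and t_tgt: "tgt A t = B"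
    using t(7,8) B by simp_all
  then have "i = from_zero A (src A t)"
    using t(4,5) by (intro from_zero_unique) auto
  then have TC: "src A t \<in> model_TC"
    using t(2,3) model_TC_iff by auto
  have "\<exists>h\<in>homset A U (src A t). f = t \<cdot> h" if U: "U \<in> model_TC" and f: "f \<in> homset A U B" for U f
  proof -
    have "lifts A (from_zero A U) t"
      using wfs_lifts[OF model_wfs(2) _ \<open>t \<in> Fib\<close>] U model_TC_iff by blast
    then obtain h where "h \<in> arr A" "src A h = U" "tgt A h = src A t" "t \<cdot> h = f"
      by (rule lifts_from_zeroE[where v = f]) (use t(3) t_tgt f in \<open>auto simp: in_homset_iff\<close>)
    then show ?thesis
      by (auto simp: in_homset_iff)
  qed
  then have "right_approximation A model_TC B t"
    using t(3) t_tgt TC by (simp add: right_approximation_def)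
  then show "\<exists>t. right_approximation A model_TC B t" ..
qed

text \<open>For left cancellation, two out of three makes \<open>g\<close> a weak equivalence. It is
  a fibration because a map that factors through \<open>g \<cdot> f\<close> factors through
  \<open>g\<close>, so being Hom-epic passes from \<open>g \<cdot> f\<close> to
  \<open>g\<close>.\<close>

theorem model_fibrantly_wfs: "fibrantly_weak_factorization_system A CoFib (Fib \<inter> Weq)"
  unfolding fibrantly_weak_factorization_system_def
proof (intro conjI ballI impI model_TC_contravariantly_finite model_wfs(1))
  have TC: "model_TC \<subseteq> obj A"
    using model_TC_iff by blast
  fix f g
  assume fg: "f \<in> arr A" "g \<in> arr A" "tgt A f = src A g" "f \<in> Fib \<inter> Weq" "g \<cdot> f \<in> Fib \<inter> Weq"
  have "g \<in> Weq"
    using model_structure_two_of_three[OF fibrant_model_model fg(1-3)] fg by blast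
  moreover have "g \<in> hom_epics A model_TC"
    unfolding mem_hom_epics_iff[OF TC]
  proof (intro conjI ballI lifts_from_zeroI)
    fix U v
    assume U: "U \<in> model_TC" and v: "v \<in> arr A" "src A v = U" "tgt A v = tgt A g"
    have "lifts A (from_zero A U) (g \<cdot> f)"
      using wfs_lifts[OF model_wfs(2)] U fg model_TC_iff by blast
    then obtain h where "h \<in> arr A" "src A h = U" "tgt A h = src A (g \<cdot> f)" "(g \<cdot> f) \<cdot> h = v"
      by (rule lifts_from_zeroE[where v = v]) (use fg v in auto)
    then show "\<exists>h\<in>arr A. src A h = U \<and> tgt A h = src A g \<and> g \<cdot> h = v"
      using fg by (intro bexI[of _ "f \<cdot> h"]) auto
  qed (use fg TC in auto)
  ultimately show "g \<in> Fib \<inter> Weq"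
    using model_fib_eq by blast
qed

end

end


section \<open>From fibrantly weak factorization systems to fibrant model structures\<close>

locale fibrantly_wfs = weakly_idempotent_complete_additive_category +
  fixes CoFib TFib
  assumes fibrantly_wfs: "fibrantly_weak_factorization_system A CoFib TFib"
begin

abbreviation TC where
  "TC \<equiv> objs_from_zero A CoFib \<inter> objs_to_zero A TFib"

abbreviation Fib where
  "Fib \<equiv> hom_epics A TC"

abbreviation TCoFib where
  "TCoFib \<equiv> splitting_monos_coker_in A TC"

abbreviation Weq where
  "Weq \<equiv> compose_classes A TFib TCoFib"

section \<open>Elementary properties of the constructed classes\<close>

lemma cofib_wfs: "weak_factorization_system A CoFib TFib"
  using fibrantly_wfs by (simp add: fibrantly_weak_factorization_system_def)

lemma tfib_left_cancel:
  assumes "f \<in> TFib" "g \<cdot> f \<in> TFib" "g \<in> arr A" "tgt A f = src A g"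
  shows "g \<in> TFib"
  using fibrantly_wfs assms wfs_right_arr[OF cofib_wfs]
  unfolding fibrantly_weak_factorization_system_def by blast

lemma TC_obj: "TC \<subseteq> obj A"
  by (auto simp: objs_from_zero_def)

lemma TC_D:
  assumes "X \<in> TC"
  shows "X \<in> obj A" "from_zero A X \<in> CoFib" "to_zero A X \<in> TFib"
  using assms by (auto simp: objs_from_zero_def objs_to_zero_def)

lemma TC_I:
  assumes "X \<in> obj A" "from_zero A X \<in> CoFib" "to_zero A X \<in> TFib"
  shows "X \<in> TC"
  using assms by (auto simp: objs_from_zero_def objs_to_zero_def)

lemma fib_arr: "f \<in> Fib \<Longrightarrow> f \<in> arr A"
  by (simp add: hom_epics_def)

lemma tcofib_arr: "f \<in> TCoFib \<Longrightarrow> f \<in> arr A"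
  by (simp add: splitting_monos_coker_in_def splitting_mono_def)

lemmas tfib_arr = wfs_right_arr[OF cofib_wfs]

lemma tcofib_lifts_fib:
  assumes "i \<in> TCoFib" "g \<in> Fib"
  shows "lifts A i g"
  using assms(2) mem_hom_epics_iff[OF TC_obj] by (intro splitting_mono_coker_lifts[OF assms(1)]) blast+

lemma tcofib_cofib:
  assumes "i \<in> TCoFib"
  shows "i \<in> CoFib"
proof (rule wfs_leftI[OF cofib_wfs tcofib_arr[OF assms]])
  show "lifts A i g" if "g \<in> TFib" for g
    using tfib_arr that TC_D(2) wfs_lifts[OF cofib_wfs _ that]
    by (intro splitting_mono_coker_lifts[OF assms]) blast+
qed

lemma tfib_fib:
  assumes "g \<in> TFib"
  shows "g \<in> Fib"
  using assms tfib_arr TC_D(2) wfs_lifts[OF cofib_wfs _ assms]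
  by (simp add: mem_hom_epics_iff[OF TC_obj])

section \<open>The weak factorization system (\<open>TCoFib\<close>, \<open>Fib\<close>)\<close>

lemma fib_retract:
  assumes "f \<in> Fib" "retract_of A g f"
  shows "g \<in> Fib"
proof -
  have "lifts A (from_zero A U) g" if "U \<in> TC" for U
    using lifts_retract_right[OF assms(2)] assms(1) that TC_D(1) mem_hom_epics_iff[OF TC_obj]
    by (meson from_zero_arr(1))
  moreover have "g \<in> arr A"
    using assms(2) by (simp add: retract_of_def)
  ultimately show ?thesis
    by (simp add: mem_hom_epics_iff[OF TC_obj])
qed

text \<open>The retraction \<open>r\<close> of \<open>i\<close> induces the retraction
  \<open>\<beta> \<cdot> (r \<cdot> \<gamma>)\<close> of \<open>f\<close>, so \<open>f\<close> has a
  complement \<open>K\<close>. It remains to place \<open>K\<close> in \<open>TC\<close>.\<close>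

lemma tcofib_retract:
  assumes i: "i \<in> TCoFib" and ret: "retract_of A f i"
  shows "f \<in> TCoFib"
proof -
  obtain q s r where q: "tgt A q \<in> TC"
    and bip: "is_biproduct A (src A i) (tgt A q) (tgt A i) i s r q"
    using i by (rule splitting_monos_coker_inE)
  note b = biproduct_simps[OF bip]
  obtain \<alpha> \<beta> \<gamma> \<delta> where ret': "f \<in> arr A" "i \<in> arr A"
    "\<alpha> \<in> arr A" "src A \<alpha> = src A f" "tgt A \<alpha> = src A i"
    "\<beta> \<in> arr A" "src A \<beta> = src A i" "tgt A \<beta> = src A f"
    "\<gamma> \<in> arr A" "src A \<gamma> = tgt A f" "tgt A \<gamma> = tgt A i"
    "\<delta> \<in> arr A" "src A \<delta> = tgt A i" "tgt A \<delta> = tgt A f"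
    and eqs: "i \<cdot> \<alpha> = \<gamma> \<cdot> f" "f \<cdot> \<beta> = \<delta> \<cdot> i" "\<beta> \<cdot> \<alpha> = idm A (src A f)" "\<delta> \<cdot> \<gamma> = idm A (tgt A f)"
    using ret by (rule retract_ofE)
  have "(\<beta> \<cdot> (r \<cdot> \<gamma>)) \<cdot> f = \<beta> \<cdot> (r \<cdot> (i \<cdot> \<alpha>))"
    unfolding eqs using ret' b by simp
  also have "\<dots> = idm A (src A f)"
    using ret' b eqs(3) by simp
  finally obtain K s' c where bip': "is_biproduct A (src A f) K (tgt A f) f s' (\<beta> \<cdot> (r \<cdot> \<gamma>)) c"
    using ret' b by (elim retraction_biproductE[rotated 4]) auto
  note b' = biproduct_simps[OF bip']
  have "f \<in> CoFib"
    using wfs_left_retract[OF cofib_wfs tcofib_cofib[OF i] ret] .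
  then have "from_zero A K \<in> CoFib"
    using wfs_left_retract[OF cofib_wfs _ from_zero_retract_biproduct_injection[OF bip']] by blast
  \<comment> \<open>The cokernel of \<open>f\<close> is a retract of the cokernel of \<open>i\<close>.\<close>
  moreover have "to_zero A K \<in> TFib"
  proof -
    have "\<gamma> \<cdot> s' = (i \<cdot> (r \<cdot> (\<gamma> \<cdot> s'))) \<oplus> (s \<cdot> (q \<cdot> (\<gamma> \<cdot> s')))"
      using ret' b' by (intro biproduct_ext_right[OF bip]) auto
    then have "(c \<cdot> \<delta>) \<cdot> (\<gamma> \<cdot> s') = (c \<cdot> \<delta>) \<cdot> ((i \<cdot> (r \<cdot> (\<gamma> \<cdot> s'))) \<oplus> (s \<cdot> (q \<cdot> (\<gamma> \<cdot> s'))))"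
      by simp
    \<comment> \<open>The summand through \<open>i\<close> vanishes, because \<open>c \<cdot>
      \<delta> \<cdot> i = c \<cdot> f \<cdot> \<beta> = 0\<close>.\<close>
    also have "\<dots> = (c \<cdot> (\<delta> \<cdot> s)) \<cdot> (q \<cdot> (\<gamma> \<cdot> s'))"
      using ret' b b' by (simp add: comp_eq_reassoc[OF eqs(2)[symmetric]])
    also have "(c \<cdot> \<delta>) \<cdot> (\<gamma> \<cdot> s') = idm A K"
      using ret' b' by (simp add: comp_eq_reassoc[OF eqs(4)])
    finally have cs: "(c \<cdot> (\<delta> \<cdot> s)) \<cdot> (q \<cdot> (\<gamma> \<cdot> s')) = idm A K" ..
    have "retract_of A (to_zero A (src A (q \<cdot> (\<gamma> \<cdot> s')))) (to_zero A (tgt A q))"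
      using cs ret' b b'
      by (intro to_zero_retract[where c = "c \<cdot> (\<delta> \<cdot> s)"]) (auto simp: to_zero_eq_zmor)
    then have "retract_of A (to_zero A K) (to_zero A (tgt A q))"
      using ret' b b' by simp
    then show ?thesis
      using wfs_right_retract[OF cofib_wfs] TC_D(3)[OF q] by blast
  qed
  ultimately have "K \<in> TC"
    using b' by (intro TC_I) auto
  with bip' show ?thesis
    by (rule biproduct_injection_coker_in)
qed

lemma tcofib_fib_factor:
  assumes f: "f \<in> arr A"
  shows "f \<in> compose_classes A Fib TCoFib"
proof -
  have "contravariantly_finite A TC"
    using fibrantly_wfs by (simp add: fibrantly_weak_factorization_system_def)
  then obtain t where t: "right_approximation A TC (tgt A f) t"
    using src_tgt_obj(2)[OF f] unfolding contravariantly_finite_def by blast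
  then have t': "t \<in> arr A" "src A t \<in> TC" "tgt A t = tgt A f"
    by (simp_all add: right_approximation_def)
  obtain S i j p q where bip: "is_biproduct A (src A f) (src A t) S i j p q"
    using ex_biproduct[of "src A f" "src A t"] f t' by auto
  note b = biproduct_simps[OF bip]
  \<comment> \<open>This is the map (f, t) on the biproduct. It is Hom-epic because every map from
    an object of \<open>TC\<close> factors through \<open>t\<close> alone.\<close>
  let ?m = "(f \<cdot> p) \<oplus> (t \<cdot> q)"
  have "?m \<in> Fib"
    unfolding mem_hom_epics_iff[OF TC_obj]
  proof (intro conjI ballI lifts_from_zeroI)
    fix U v
    assume "U \<in> TC" and v: "v \<in> arr A" "src A v = U" "tgt A v = tgt A ?m"
    moreover have "v \<in> homset A U (tgt A f)"
      using v f t' b by (simp add: in_homset_iff)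
    ultimately obtain h where "h \<in> homset A U (src A t)" "v = t \<cdot> h"
      using t unfolding right_approximation_def by blast
    then show "\<exists>h\<in>arr A. src A h = U \<and> tgt A h = src A ?m \<and> ?m \<cdot> h = v"
      using f t' b by (intro bexI[of _ "j \<cdot> h"]) (auto simp: in_homset_iff)
  qed (use f t' b TC_D(1) in auto)
  moreover have "i \<in> TCoFib"
    using bip t'(2) by (rule biproduct_injection_coker_in)
  moreover have "?m \<cdot> i = f"
    using f t' b by simp
  ultimately show ?thesis
    using f t' b compose_classesI[of ?m Fib i TCoFib] by simp
qed

lemma tcofib_wfs: "weak_factorization_system A TCoFib Fib"
  unfolding weak_factorization_system_def retract_closed_def
  using tcofib_arr fib_arr tcofib_retract fib_retract tcofib_lifts_fib tcofib_fib_factor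
  by blast

text \<open>Every retraction of \<open>i\<close> is the projection of a biproduct decomposition with
  complement Coker i. Lifting against that projection reduces to lifting against Coker i -> 0, which
  is in \<open>TFib\<close>.\<close>

lemma retraction_of_tcofib_tfib:
  assumes i: "i \<in> TCoFib" and r: "r \<in> arr A" "src A r = tgt A i" "tgt A r = src A i"
    "r \<cdot> i = idm A (src A i)"
  shows "r \<in> TFib"
proof -
  obtain c where c: "is_cokernel A i c" "tgt A c \<in> TC"
    using i by (auto simp: splitting_monos_coker_in_def)
  obtain s where bip: "is_biproduct A (src A i) (tgt A c) (tgt A i) i s r c"
    using retraction_biproduct[OF c(1) r] .
  show ?thesis
  proof (rule wfs_rightI[OF cofib_wfs r(1)])
    show "lifts A l r" if "l \<in> CoFib" for l
      using lifts_biproduct_projection[OF bip] wfs_lifts[OF cofib_wfs that TC_D(3)[OF c(2)]]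
        wfs_left_arr[OF cofib_wfs that] by blast
  qed
qed

lemma tcofib_retractionE:
  assumes "i \<in> TCoFib"
  obtains r where "r \<in> TFib" "r \<in> arr A" "src A r = tgt A i" "tgt A r = src A i"
    "r \<cdot> i = idm A (src A i)"
proof -
  obtain r where "r \<in> arr A" "src A r = tgt A i" "tgt A r = src A i" "r \<cdot> i = idm A (src A i)"
    using assms unfolding splitting_monos_coker_in_def splitting_mono_def
    by (auto simp: in_homset_iff)
  then show thesis
    using that retraction_of_tcofib_tfib[OF assms] by blast
qed

section \<open>Weak equivalences and their intersections with \<open>Fib\<close> and
  \<open>CoFib\<close>\<close>

lemma WeqE:
  assumes "f \<in> Weq"
  obtains p i where "p \<in> TFib" "i \<in> TCoFib" "p \<in> arr A" "i \<in> arr A" "tgt A i = src A p"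
    "f = p \<cdot> i" "f \<in> arr A" "src A f = src A i" "tgt A f = tgt A p"
  using assms by (rule compose_classesE) (use that tfib_arr tcofib_arr in auto)

lemma WeqI:
  assumes "p \<in> TFib" "i \<in> TCoFib" "tgt A i = src A p"
  shows "p \<cdot> i \<in> Weq"
  using assms by (rule compose_classesI)

lemma tfib_Weq:
  assumes "p \<in> TFib"
  shows "p \<in> Weq"
  using WeqI[OF assms wfs_left_idm[OF tcofib_wfs], of "src A p"] tfib_arr[OF assms] by simp

lemma tfib_idm:
  assumes "X \<in> obj A"
  shows "idm A X \<in> TFib"
proof (rule retraction_of_tcofib_tfib)
  show "idm A X \<in> TCoFib"
    using assms by (rule wfs_left_idm[OF tcofib_wfs])
qed (use assms in auto)

lemma tcofib_Weq:
  assumes "i \<in> TCoFib"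
  shows "i \<in> Weq"
  using WeqI[OF tfib_idm assms, of "tgt A i"] tcofib_arr[OF assms] by simp

text \<open>In \<open>f = p \<cdot> i\<close> the left factor \<open>i\<close> lifts against the
  fibration \<open>f\<close>, so the retract argument makes \<open>f\<close> a retract of
  \<open>p\<close>.\<close>

lemma Weq_fib_tfib:
  assumes "f \<in> Weq" "f \<in> Fib"
  shows "f \<in> TFib"
proof -
  obtain p i where pi: "p \<in> TFib" "i \<in> TCoFib" "p \<in> arr A" "i \<in> arr A" "tgt A i = src A p"
    "f = p \<cdot> i"
    using assms(1) by (rule WeqE)
  then have "retract_of A (p \<cdot> i) p"
    using assms(2) tcofib_lifts_fib by (intro retract_of_right_factor) auto
  with pi show ?thesis
    using wfs_right_retract[OF cofib_wfs] by blast
qed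

lemma Weq_cofib_tcofib:
  assumes "f \<in> Weq" "f \<in> CoFib"
  shows "f \<in> TCoFib"
proof -
  obtain p i where pi: "p \<in> TFib" "i \<in> TCoFib" "p \<in> arr A" "i \<in> arr A" "tgt A i = src A p"
    "f = p \<cdot> i"
    using assms(1) by (rule WeqE)
  then have "retract_of A (p \<cdot> i) i"
    using assms(2) wfs_lifts[OF cofib_wfs] by (intro retract_of_left_factor) auto
  with pi show ?thesis
    using tcofib_retract by blast
qed

section \<open>Cancellation properties of \<open>TFib\<close>\<close>

lemma tfib_tcofib_cancel:
  assumes "q \<in> arr A" "b \<in> TCoFib" "tgt A b = src A q" "q \<cdot> b \<in> TFib"
  shows "q \<in> TFib"
proof -
  note b = tcofib_arr[OF assms(2)]
  \<comment> \<open>Lifting an identity against \<open>q \<cdot> b\<close> yields a retraction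
    \<open>\<rho>\<close> of \<open>b\<close> with \<open>(q \<cdot> b) \<cdot> \<rho> = q\<close>.
    As \<open>\<rho>\<close> is in \<open>TFib\<close>, this writes \<open>q\<close> as a composite
    of maps in \<open>TFib\<close>.\<close>
  have "lifts A b (q \<cdot> b)"
    using assms(2,4) tfib_fib tcofib_lifts_fib by blast
  then obtain \<rho> where \<rho>: "\<rho> \<in> arr A" "src A \<rho> = tgt A b" "tgt A \<rho> = src A (q \<cdot> b)"
    "\<rho> \<cdot> b = idm A (src A b)" "(q \<cdot> b) \<cdot> \<rho> = q"
    by (rule liftsE[where u = "idm A (src A b)" and v = q]) (use assms(1,3) b in auto)
  then have "\<rho> \<in> TFib"
    using assms b by (intro retraction_of_tcofib_tfib[OF assms(2)]) auto
  then have "(q \<cdot> b) \<cdot> \<rho> \<in> TFib"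
    using assms(4) \<rho>(3) by (rule wfs_right_comp[OF cofib_wfs])
  then show ?thesis
    using \<rho>(5) by simp
qed

text \<open>Factor \<open>p = p' \<cdot> j\<close> with \<open>p'\<close> in \<open>TFib\<close> and \<open>j\<close> in \<open>CoFib\<close>. Lifting \<open>j\<close> against
  \<open>q \<cdot> p\<close> yields a retraction of \<open>j\<close> for which \<open>q \<cdot> p'\<close> vanishes on the complement \<open>K\<close>; so
  \<open>K \<rightarrow> 0\<close> is a retract of \<open>q \<cdot> p'\<close>, whence \<open>j\<close> is in \<open>TCoFib\<close>.\<close>

lemma tfib_right_cancel:
  assumes "q \<in> TFib" "q \<cdot> p \<in> TFib" "p \<in> Fib" "tgt A p = src A q"
  shows "p \<in> TFib"
proof -
  note arrs = tfib_arr[OF assms(1)] fib_arr[OF assms(3)]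
  obtain p' j where j: "p' \<in> TFib" "j \<in> CoFib" "p' \<in> arr A" "j \<in> arr A" "tgt A j = src A p'"
    "p = p' \<cdot> j" "src A j = src A p" "tgt A p' = tgt A p"
    using arrs(2) by (rule wfs_factorE[OF cofib_wfs])
  have qp: "(q \<cdot> p') \<cdot> j = q \<cdot> p"
    using arrs assms(4) j(3-5,8) by (simp flip: j(6))
  have "lifts A j (q \<cdot> p)"
    using wfs_lifts[OF cofib_wfs j(2) assms(2)] .
  then obtain h where h: "h \<in> arr A" "src A h = tgt A j" "tgt A h = src A (q \<cdot> p)"
    "h \<cdot> j = idm A (src A j)" "(q \<cdot> p) \<cdot> h = q \<cdot> p'"
    by (rule liftsE[where u = "idm A (src A j)" and v = "q \<cdot> p'"])
      (use arrs assms(4) j(3-5,7,8) qp in simp_all)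
  have "tgt A h = src A j"
    using h(3) arrs assms(4) j(7) by simp
  then obtain K s c where bip: "is_biproduct A (src A j) K (tgt A j) j s h c"
    using retraction_biproductE[OF j(4) h(1,2) _ h(4)] by blast
  note b = biproduct_simps[OF bip]
  have "from_zero A K \<in> CoFib"
    using wfs_left_retract[OF cofib_wfs j(2) from_zero_retract_biproduct_injection[OF bip]] .
  moreover have "to_zero A K \<in> TFib"
  proof -
    have qp': "q \<cdot> p' \<in> TFib"
      using j assms by (intro wfs_right_comp[OF cofib_wfs]) auto
    have "(q \<cdot> p') \<cdot> s = ((q \<cdot> p) \<cdot> h) \<cdot> s"
      using h(5) by simp
    also have "\<dots> = zmor A (src A s) (tgt A (q \<cdot> p'))"
      using arrs assms(4) b j(3,5,7,8) by simp
    finally have "retract_of A (to_zero A (src A s)) (q \<cdot> p')"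
      using arrs assms(4) b j(3,5,7,8) by (intro to_zero_retract[where c = c]) auto
    then show ?thesis
      using wfs_right_retract[OF cofib_wfs qp'] b by simp
  qed
  ultimately have "K \<in> TC"
    using b by (intro TC_I) auto
  then have "j \<in> TCoFib"
    by (rule biproduct_injection_coker_in[OF bip])
  \<comment> \<open>Now \<open>p = p' \<cdot> j\<close> is a weak equivalence as well as a
    fibration.\<close>
  then show ?thesis
    using WeqI[OF j(1) _ j(5)] j(6) assms(3) by (auto intro: Weq_fib_tfib)
qed

lemma tfib_tcofib_cancel_fib:
  assumes "i \<in> TCoFib" "tgt A i = src A q" "q \<in> arr A" "r \<in> TFib" "tgt A q = src A r"
    "r \<cdot> (q \<cdot> i) \<in> TFib" "q \<in> Fib"
  shows "q \<in> TFib"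
proof -
  have rq: "r \<cdot> q \<in> TFib"
    by (rule tfib_tcofib_cancel[OF _ assms(1)])
      (use assms tfib_arr tcofib_arr in auto)
  show ?thesis
    by (rule tfib_right_cancel[OF assms(4) rq]) (use assms in auto)
qed

text \<open>Compare \<open>q \<cdot> j\<close> with a factorization \<open>p \<cdot> i\<close> by a
  lift \<open>h\<close>, and factor \<open>h = a \<cdot> b\<close> with \<open>a\<close> in
  \<open>Fib\<close> and \<open>b\<close> in \<open>TCoFib\<close>. Since
  \<open>(q \<cdot> a) \<cdot> b = p\<close>, the map \<open>q \<cdot> a\<close> is in
  \<open>TFib\<close>. Once \<open>a\<close> is in \<open>TFib\<close> too, the assumed left
  cancellation gives \<open>q\<close>.\<close>

lemma Weq_tcofib_cancel:
  assumes j: "j \<in> TCoFib" and q: "q \<in> Fib" "tgt A j = src A q" and qj: "q \<cdot> j \<in> Weq"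
  shows "q \<in> TFib"
proof -
  note arrs = tcofib_arr[OF j] fib_arr[OF q(1)]
  obtain p i where pi: "p \<in> TFib" "i \<in> TCoFib" "p \<in> arr A" "i \<in> arr A" "tgt A i = src A p"
    "q \<cdot> j = p \<cdot> i" "src A (q \<cdot> j) = src A i" "tgt A (q \<cdot> j) = tgt A p"
    using qj by (rule WeqE)
  have ends: "src A i = src A j" "tgt A p = tgt A q"
    using pi(7,8) arrs q(2) by simp_all
  have "lifts A i q"
    using pi(2) q(1) by (rule tcofib_lifts_fib)
  then obtain h where h: "h \<in> arr A" "src A h = tgt A i" "tgt A h = src A q" "h \<cdot> i = j" "q \<cdot> h = p"
    by (rule liftsE[where u = j and v = p]) (use arrs pi ends q in auto)
  obtain a b where ab: "a \<in> Fib" "b \<in> TCoFib" "a \<in> arr A" "b \<in> arr A" "tgt A b = src A a"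
    "h = a \<cdot> b" "src A b = src A h" "tgt A a = tgt A h"
    using h(1) by (rule wfs_factorE[OF tcofib_wfs])
  obtain r where r: "r \<in> TFib" "r \<in> arr A" "src A r = tgt A j" "tgt A r = src A j"
    "r \<cdot> j = idm A (src A j)"
    using j by (rule tcofib_retractionE)
  have ab_ends: "src A b = tgt A i" "tgt A a = src A q"
    using ab(7,8) h(2,3) by simp_all
  have abi: "a \<cdot> (b \<cdot> i) = j"
    using ab(3-5) pi(4) ab_ends(1) by (simp flip: h(4) add: ab(6))
  have qa: "q \<cdot> a \<in> TFib"
    by (rule tfib_tcofib_cancel[OF _ ab(2)])
      (use arrs(2) ab(3-5) ab_ends h(5) pi(1) in \<open>auto simp: ab(6)\<close>)
  have "b \<cdot> i \<in> TCoFib"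
    using pi(2) ab(2) ab_ends(1)[symmetric] by (rule wfs_left_comp[OF tcofib_wfs])
  \<comment> \<open>Since \<open>a \<cdot> (b \<cdot> i) = j\<close>, the map
    \<open>r \<cdot> a\<close> is a retraction of \<open>b \<cdot> i\<close>. Thus \<open>r\<close>
    and \<open>r \<cdot> a\<close> are in \<open>TFib\<close>, and right cancellation applies to
    \<open>a\<close>.\<close>
  moreover have "(r \<cdot> a) \<cdot> (b \<cdot> i) = idm A (src A (b \<cdot> i))"
    using r ab(3-5) ab_ends abi pi(4) ends(1) q(2) by simp
  ultimately have ra: "r \<cdot> a \<in> TFib"
    using r ab(3-5) ab_ends pi(4) ends(1) q(2) by (intro retraction_of_tcofib_tfib[of "b \<cdot> i"]) auto
  have "a \<in> TFib"
    by (rule tfib_right_cancel[OF r(1) ra]) (use r ab(1) ab_ends q(2) in auto)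
  from tfib_left_cancel[OF this qa] show ?thesis
    using arrs(2) ab_ends by simp
qed

section \<open>Two out of three\<close>

lemma Weq_comp:
  assumes "f \<in> Weq" "g \<in> Weq" "tgt A f = src A g"
  shows "g \<cdot> f \<in> Weq"
proof -
  obtain p i where pi: "p \<in> TFib" "i \<in> TCoFib" "p \<in> arr A" "i \<in> arr A" "tgt A i = src A p"
    "f = p \<cdot> i" "tgt A f = tgt A p"
    using assms(1) by (rule WeqE)
  obtain q j where qj: "q \<in> TFib" "j \<in> TCoFib" "q \<in> arr A" "j \<in> arr A" "tgt A j = src A q"
    "g = q \<cdot> j" "src A g = src A j"
    using assms(2) by (rule WeqE)
  have mid: "tgt A p = src A j"
    using assms(3) pi(7) qj(7) by simp
  \<comment> \<open>The middle part \<open>j \<cdot> p\<close> of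
    \<open>q \<cdot> j \<cdot> p \<cdot> i\<close> has its factors in the wrong order. It is
    rewritten as \<open>a \<cdot> b\<close>; a retraction \<open>r\<close> of \<open>j\<close> gives
    \<open>r \<cdot> (a \<cdot> b) = p\<close>, and cancellation puts \<open>a\<close> in
    \<open>TFib\<close>.\<close>
  have "j \<cdot> p \<in> arr A"
    using pi qj mid by simp
  then obtain a b where ab: "a \<in> Fib" "b \<in> TCoFib" "a \<in> arr A" "b \<in> arr A" "tgt A b = src A a"
    "j \<cdot> p = a \<cdot> b" "src A b = src A (j \<cdot> p)" "tgt A a = tgt A (j \<cdot> p)"
    by (rule wfs_factorE[OF tcofib_wfs])
  have ends: "src A b = src A p" "tgt A a = tgt A j"
    using ab(7,8) pi(3) qj(4) mid by simp_all
  obtain r where r: "r \<in> TFib" "r \<in> arr A" "src A r = tgt A j" "tgt A r = src A j"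
    "r \<cdot> j = idm A (src A j)"
    using qj(2) by (rule tcofib_retractionE)
  have rab: "r \<cdot> (a \<cdot> b) = p"
    using r pi(3) qj(4) mid by (simp flip: ab(6) add: comp_eq_reassoc[OF r(5)])
  have "a \<in> TFib"
    by (rule tfib_tcofib_cancel_fib[of b a r]) (use rab pi(1) r ab(1-5) ends in auto)
  then have "(q \<cdot> a) \<cdot> (b \<cdot> i) \<in> Weq"
    using pi(1-5) qj(1-5) ab(2-5) ends
    by (intro WeqI wfs_right_comp[OF cofib_wfs] wfs_left_comp[OF tcofib_wfs]) auto
  moreover have "(q \<cdot> a) \<cdot> (b \<cdot> i) = q \<cdot> ((a \<cdot> b) \<cdot> i)"
    using pi(3-5) qj(3-5) ab(3-5) ends by simp
  moreover have "\<dots> = g \<cdot> f"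
    using pi(3-6) qj(3-6) mid by (simp flip: ab(6))
  ultimately show ?thesis
    by simp
qed

text \<open>With \<open>g = q \<cdot> j\<close> and \<open>j \<cdot> f = p \<cdot> i\<close>, the
  composite \<open>g \<cdot> f\<close> becomes \<open>(q \<cdot> p) \<cdot> i\<close>. Then
  \<open>Weq_tcofib_cancel\<close> puts \<open>q \<cdot> p\<close> in \<open>TFib\<close>, and left
  cancellation of \<open>p\<close> gives \<open>q\<close>.\<close>

lemma Weq_left_cancel:
  assumes "f \<in> Weq" "g \<cdot> f \<in> Weq" "g \<in> arr A" "tgt A f = src A g"
  shows "g \<in> Weq"
proof -
  obtain q j where qj: "q \<in> Fib" "j \<in> TCoFib" "q \<in> arr A" "j \<in> arr A" "tgt A j = src A q"
    "g = q \<cdot> j" "src A j = src A g"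
    using assms(3) by (rule wfs_factorE[OF tcofib_wfs])
  have f: "f \<in> arr A"
    using assms(1) by (rule WeqE)
  have "j \<cdot> f \<in> Weq"
    using assms(1) tcofib_Weq[OF qj(2)] by (rule Weq_comp) (use assms(4) qj(7) in simp)
  then obtain p i where pi: "p \<in> TFib" "i \<in> TCoFib" "p \<in> arr A" "i \<in> arr A" "tgt A i = src A p"
    "j \<cdot> f = p \<cdot> i" "tgt A (j \<cdot> f) = tgt A p"
    by (rule WeqE)
  have pq: "tgt A p = src A q"
    using pi(7) f qj(4,5,7) assms(4) by simp
  have qpi: "(q \<cdot> p) \<cdot> i = g \<cdot> f"
    using pi(3-5) pq qj(3-7) f assms(4) by (simp flip: pi(6))
  have qp: "q \<cdot> p \<in> TFib"
    by (rule Weq_tcofib_cancel[OF pi(2)])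
      (use qpi assms(2) pi(3-5) pq qj(1,3) pi(1) wfs_right_comp[OF tcofib_wfs, of p q] tfib_fib in auto)
  have "q \<in> TFib"
    using pi(1) qp qj(3) pq by (rule tfib_left_cancel)
  then show ?thesis
    unfolding qj(6) using qj(2,5) by (rule WeqI)
qed

text \<open>The same rewriting, now with \<open>q\<close> known to be in \<open>TFib\<close> and
  \<open>p\<close> only in \<open>Fib\<close>: right cancellation gives \<open>p\<close>, so
  \<open>j \<cdot> f\<close> is a weak equivalence. A retraction of \<open>j\<close> then recovers
  \<open>f\<close>.\<close>

lemma Weq_right_cancel:
  assumes "g \<in> Weq" "g \<cdot> f \<in> Weq" "f \<in> arr A" "tgt A f = src A g"
  shows "f \<in> Weq"
proof -
  obtain q j where qj: "q \<in> TFib" "j \<in> TCoFib" "q \<in> arr A" "j \<in> arr A" "tgt A j = src A q"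
    "g = q \<cdot> j" "src A g = src A j"
    using assms(1) by (rule WeqE)
  have fj: "tgt A f = src A j"
    using assms(4) qj(7) by simp
  then have "j \<cdot> f \<in> arr A"
    using assms(3) qj(4) by simp
  then obtain p i where pi: "p \<in> Fib" "i \<in> TCoFib" "p \<in> arr A" "i \<in> arr A" "tgt A i = src A p"
    "j \<cdot> f = p \<cdot> i" "tgt A p = tgt A (j \<cdot> f)"
    by (rule wfs_factorE[OF tcofib_wfs])
  have pq: "tgt A p = src A q"
    using pi(7) assms(3) fj qj(4,5) by simp
  have qpi: "(q \<cdot> p) \<cdot> i = g \<cdot> f"
    using pi(3-5) pq qj(3-6) fj assms(3) by (simp flip: pi(6))
  have qp: "q \<cdot> p \<in> TFib"
    by (rule Weq_tcofib_cancel[OF pi(2)])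
      (use qpi assms(2) pi(3-5) pq qj(1,3) pi(1) wfs_right_comp[OF tcofib_wfs, of p q] tfib_fib in auto)
  have "p \<in> TFib"
    using qj(1) qp pi(1) pq by (rule tfib_right_cancel)
  then have jf: "j \<cdot> f \<in> Weq"
    unfolding pi(6) using pi(2,5) by (rule WeqI)
  obtain r where r: "r \<in> TFib" "r \<in> arr A" "src A r = tgt A j" "tgt A r = src A j"
    "r \<cdot> j = idm A (src A j)"
    using qj(2) by (rule tcofib_retractionE)
  have "r \<cdot> (j \<cdot> f) \<in> Weq"
    using jf tfib_Weq[OF r(1)] by (rule Weq_comp) (use r(3) qj(4) fj assms(3) in simp)
  moreover have "r \<cdot> (j \<cdot> f) = f"
    using r qj(4) fj assms(3) by (simp add: comp_eq_reassoc[OF r(5)])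
  ultimately show ?thesis
    by simp
qed

text \<open>Write \<open>f = p \<cdot> i\<close> as a weak equivalence and factor \<open>g = q \<cdot> j\<close> with \<open>q\<close> in \<open>Fib\<close>. Lifting
  compares \<open>q\<close> and \<open>p\<close> by maps \<open>\<alpha>\<close> and \<open>\<beta>\<close> whose composite \<open>\<beta> \<cdot> \<alpha>\<close> differs from the identity
  by a map factoring through \<open>Coker j\<close>; so \<open>q\<close> is a retract of \<open>(p, 0)\<close> on
  \<open>src p \<oplus> Coker j\<close>.\<close>

lemma Weq_retract:
  assumes f: "f \<in> Weq" and ret: "retract_of A g f"
  shows "g \<in> Weq"
proof -
  obtain a b c d where ret': "g \<in> arr A" "f \<in> arr A"
    "a \<in> arr A" "src A a = src A g" "tgt A a = src A f"
    "b \<in> arr A" "src A b = src A f" "tgt A b = src A g"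
    "c \<in> arr A" "src A c = tgt A g" "tgt A c = tgt A f"
    "d \<in> arr A" "src A d = tgt A f" "tgt A d = tgt A g"
    and eqs: "f \<cdot> a = c \<cdot> g" "g \<cdot> b = d \<cdot> f" "b \<cdot> a = idm A (src A g)" "d \<cdot> c = idm A (tgt A g)"
    using ret by (rule retract_ofE)
  obtain p i where pi: "p \<in> TFib" "i \<in> TCoFib" "p \<in> arr A" "i \<in> arr A" "tgt A i = src A p"
    "f = p \<cdot> i" "src A f = src A i" "tgt A f = tgt A p"
    using f by (rule WeqE)
  obtain q j where qj: "q \<in> Fib" "j \<in> TCoFib" "q \<in> arr A" "j \<in> arr A" "tgt A j = src A q"
    "g = q \<cdot> j" "src A j = src A g" "tgt A q = tgt A g"
    using ret'(1) by (rule wfs_factorE[OF tcofib_wfs])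
  have g_ends: "src A g = src A j" "tgt A g = tgt A q"
    using qj(7,8) by simp_all
  have sq1: "p \<cdot> (i \<cdot> a) = (c \<cdot> q) \<cdot> j"
  proof -
    have "p \<cdot> (i \<cdot> a) = f \<cdot> a"
      using ret'(3-5) pi(3-5,7) by (simp add: pi(6))
    also have "\<dots> = (c \<cdot> q) \<cdot> j"
      unfolding eqs(1) using ret'(9-11) qj(3-5) g_ends by (simp add: qj(6))
    finally show ?thesis .
  qed
  have sq2: "q \<cdot> (j \<cdot> b) = (d \<cdot> p) \<cdot> i"
  proof -
    have "q \<cdot> (j \<cdot> b) = g \<cdot> b"
      using ret'(6-8) qj(3-5) g_ends by (simp add: comp_eq_reassoc[OF qj(6)[symmetric]])
    also have "\<dots> = (d \<cdot> p) \<cdot> i"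
      unfolding eqs(2) using ret'(12-14) pi(3-5,8) by (simp add: pi(6))
    finally show ?thesis .
  qed
  have "lifts A j p"
    using qj(2) tfib_fib[OF pi(1)] by (rule tcofib_lifts_fib)
  then obtain \<alpha> where \<alpha>: "\<alpha> \<in> arr A" "src A \<alpha> = tgt A j" "tgt A \<alpha> = src A p"
    "\<alpha> \<cdot> j = i \<cdot> a" "p \<cdot> \<alpha> = c \<cdot> q"
    by (rule liftsE[where u = "i \<cdot> a" and v = "c \<cdot> q"])
      (use ret'(1-14) pi(3-5,7,8) qj(3-5) g_ends sq1 in simp_all)
  have "lifts A i q"
    using pi(2) qj(1) by (rule tcofib_lifts_fib)
  then obtain \<beta> where \<beta>: "\<beta> \<in> arr A" "src A \<beta> = tgt A i" "tgt A \<beta> = src A q"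
    "\<beta> \<cdot> i = j \<cdot> b" "q \<cdot> \<beta> = d \<cdot> p"
    by (rule liftsE[where u = "j \<cdot> b" and v = "d \<cdot> p"])
      (use ret'(1-14) pi(3-5,7,8) qj(3-5) g_ends sq2 in simp_all)
  let ?D = "src A q"
  have \<beta>\<alpha>: "\<beta> \<cdot> \<alpha> \<in> arr A" "src A (\<beta> \<cdot> \<alpha>) = ?D" "tgt A (\<beta> \<cdot> \<alpha>) = ?D"
    using \<alpha>(1-3) \<beta>(1-3) pi(5) qj(5) by simp_all
  have \<beta>\<alpha>j: "(\<beta> \<cdot> \<alpha>) \<cdot> j = j"
    using \<alpha> \<beta>(1-3) pi(3-5,7) qj(4,5) g_ends ret' eqs(3) comp_eq_reassoc[OF \<beta>(4), of a] by simp
  have q\<beta>\<alpha>: "q \<cdot> (\<beta> \<cdot> \<alpha>) = q"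
    using \<alpha> \<beta>(1-3) pi(3-5,8) qj(3,5) g_ends ret' comp_eq_reassoc[OF \<beta>(5), of \<alpha>]
      comp_eq_reassoc[OF eqs(4), of q] by simp
  \<comment> \<open>The error term \<open>e = 1 - \<beta> \<cdot> \<alpha>\<close> satisfies
    \<open>e \<cdot> j = 0\<close> and \<open>q \<cdot> e = 0\<close>. Hence it factors as
    \<open>n \<cdot> k\<close> through Coker j, with \<open>q \<cdot> n = 0\<close>.\<close>
  obtain e where e: "e \<in> arr A" "src A e = ?D" "tgt A e = ?D" "(\<beta> \<cdot> \<alpha>) \<oplus> e = idm A ?D"
    by (rule ex_difference[of "\<beta> \<cdot> \<alpha>" "idm A ?D"]) (use \<beta>\<alpha> qj(3) in auto)
  have "((\<beta> \<cdot> \<alpha>) \<oplus> e) \<cdot> j = j"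
    unfolding e(4) using qj(3-5) by simp
  then have "j \<oplus> (e \<cdot> j) = j"
    using \<beta>\<alpha> \<beta>\<alpha>j e(1-3) qj(3-5) by (simp add: comp_add(2) del: comp_assoc_arr)
  then have ej: "e \<cdot> j = zmor A (src A j) ?D"
    using add_left_imp_zmor[of j "e \<cdot> j"] e(1-3) qj(4,5) by simp
  have "q \<cdot> ((\<beta> \<cdot> \<alpha>) \<oplus> e) = q"
    unfolding e(4) using qj(3) by simp
  then have "q \<oplus> (q \<cdot> e) = q"
    using \<beta>\<alpha> q\<beta>\<alpha> e(1-3) qj(3) by simp
  then have qe: "q \<cdot> e = zmor A ?D (tgt A q)"
    using add_left_imp_zmor[of q "q \<cdot> e"] e(1-3) qj(3) by simp
  obtain k where k: "is_cokernel A j k" "tgt A k \<in> TC"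
    using qj(2) by (auto simp: splitting_monos_coker_in_def)
  note k' = cokernel_arr[OF k(1)]
  obtain n where n: "n \<in> arr A" "src A n = tgt A k" "tgt A n = tgt A e" "n \<cdot> k = e"
    by (rule cokernel_factorE[OF k(1), of e]) (use e(1-3) ej qj(5) in auto)
  have "(q \<cdot> n) \<cdot> k = zmor A (tgt A k) (tgt A q) \<cdot> k"
    using n k' e(3) qj(3,5) qe by simp
  then have qn: "q \<cdot> n = zmor A (tgt A k) (tgt A q)"
    using n k' e(3) qj(3) by (intro cokernel_cancel[OF k(1), of "q \<cdot> n"]) simp_all
  obtain S \<iota>1 \<iota>2 \<pi>1 \<pi>2 where bip: "is_biproduct A (src A p) (tgt A k) S \<iota>1 \<iota>2 \<pi>1 \<pi>2"
    using ex_biproduct[of "src A p" "tgt A k"] pi(3) k' by auto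
  note B = biproduct_simps[OF bip]
  have "\<iota>1 \<in> TCoFib"
    using bip k(2) by (rule biproduct_injection_coker_in)
  then have "\<pi>1 \<in> TFib"
    using B by (intro retraction_of_tcofib_tfib[of \<iota>1]) auto
  then have p\<pi>1: "p \<cdot> \<pi>1 \<in> TFib"
    using pi(1) B by (intro wfs_right_comp[OF cofib_wfs]) auto
  \<comment> \<open>The second components absorb the error: \<open>?b \<cdot> ?a = \<beta> \<cdot>
    \<alpha> \<oplus> n \<cdot> k\<close> is the identity, while \<open>p \<cdot> \<pi>1\<close>
    ignores \<open>k\<close> and \<open>q\<close> kills \<open>n\<close>.\<close>
  let ?a = "(\<iota>1 \<cdot> \<alpha>) \<oplus> (\<iota>2 \<cdot> k)" and ?b = "(\<beta> \<cdot> \<pi>1) \<oplus> (n \<cdot> \<pi>2)"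
  have a: "?a \<in> arr A" "src A ?a = ?D" "tgt A ?a = S"
    using B \<alpha>(1-3) k'(2,3) qj(5) by simp_all
  have b: "?b \<in> arr A" "src A ?b = S" "tgt A ?b = ?D"
    using B \<beta>(1-3) n(1-3) e(3) pi(5) by simp_all
  have "\<pi>1 \<cdot> ?a = \<alpha>" "\<pi>2 \<cdot> ?a = k"
    using B \<alpha>(1-3) k'(2,3) qj(5) by simp_all
  then have "?b \<cdot> ?a = (\<beta> \<cdot> \<alpha>) \<oplus> (n \<cdot> k)"
    using a B \<beta>(1-3) n(1-3) e(3) pi(5) by (simp del: comp_add(1))
  then have ba: "?b \<cdot> ?a = idm A ?D"
    using n(4) e(4) by simp
  have pa: "(p \<cdot> \<pi>1) \<cdot> ?a = c \<cdot> q"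
    using \<open>\<pi>1 \<cdot> ?a = \<alpha>\<close> a B pi(3) \<alpha>(5) by (simp del: comp_add(1))
  have qb: "q \<cdot> ?b = d \<cdot> (p \<cdot> \<pi>1)"
    using B \<beta> n(1-3) e(3) pi(3,5,8) qj(3) g_ends ret'(12-14) k'
    by (simp add: comp_eq_reassoc[OF \<beta>(5)] comp_eq_reassoc[OF qn])
  have "retract_of A q (p \<cdot> \<pi>1)"
    using a b ba pa qb eqs(4) ret'(9-14) pi(3,8) B qj(3) g_ends
    by (intro retract_ofI[where a = ?a and b = ?b and c = c and d = d]) simp_all
  then have "q \<in> TFib"
    using wfs_right_retract[OF cofib_wfs p\<pi>1] by blast
  then show ?thesis
    unfolding qj(6) using qj(2,5) by (rule WeqI)
qed

section \<open>Assembling the fibrant model structure\<close>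

lemma to_zero_fib:
  assumes "X \<in> obj A"
  shows "to_zero A X \<in> Fib"
  unfolding mem_hom_epics_iff[OF TC_obj]
proof (intro conjI ballI lifts_from_zeroI)
  fix U v
  assume "v \<in> arr A" "src A v = U" "tgt A v = tgt A (to_zero A X)"
  then have "U \<in> obj A" "v = to_zero A U"
    using assms by (auto intro: to_zero_unique)
  then show "\<exists>h\<in>arr A. src A h = U \<and> tgt A h = src A (to_zero A X) \<and> to_zero A X \<cdot> h = v"
    using assms by (intro bexI[of _ "zmor A U X"]) (auto simp: to_zero_eq_zmor)
qed (use assms TC_D(1) in auto)

lemma fib_Weq_eq: "Fib \<inter> Weq = TFib"
  using tfib_fib tfib_Weq Weq_fib_tfib by blast

lemma cofib_Weq_eq: "CoFib \<inter> Weq = TCoFib"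
  using tcofib_cofib tcofib_Weq Weq_cofib_tcofib by blast

theorem fibrant_model: "fibrant_model_structure A CoFib Fib Weq"
  unfolding fibrant_model_structure_def model_structure_def fib_Weq_eq cofib_Weq_eq
\<comment> \<open>With the trivial classes identified as \<open>TFib\<close> and
  \<open>TCoFib\<close>, lifting and factorization are those of the two weak factorization
  systems.\<close>
proof (intro conjI ballI impI)
  show "CoFib \<subseteq> arr A" "Fib \<subseteq> arr A" "Weq \<subseteq> arr A"
    using wfs_left_arr[OF cofib_wfs] fib_arr by (auto elim: WeqE)
  show "retract_closed A CoFib" "retract_closed A Fib" "retract_closed A Weq"
    using wfs_left_retract[OF cofib_wfs] fib_retract Weq_retract unfolding retract_closed_def
    by blast+
  show "lifts A f g" if "f \<in> CoFib" "g \<in> Fib" "f \<in> Weq \<or> g \<in> Weq" for f g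
    using that wfs_lifts[OF cofib_wfs] tcofib_lifts_fib Weq_fib_tfib Weq_cofib_tcofib by blast
  show "f \<in> compose_classes A Fib TCoFib" "f \<in> compose_classes A TFib CoFib" if "f \<in> arr A" for f
    using that tcofib_fib_factor cofib_wfs unfolding weak_factorization_system_def by blast+
qed (use Weq_comp Weq_left_cancel Weq_right_cancel to_zero_fib in blast)+

end

theorem theorem1p4:
  fixes A :: "('o, 'm) addcat"
  assumes "weakly_idempotent_complete_additive_category A"
  shows
    "(\<forall>CoFib Fib Weq. fibrant_model_structure A CoFib Fib Weq \<longrightarrow>
        (let TCoFib = CoFib \<inter> Weq;
             TFib = Fib \<inter> Weq;
             \<C> = objs_from_zero A CoFib;
             \<W> = objs_to_zero A TFib;
             T\<C> = \<C> \<inter> \<W>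
         in fibrantly_weak_factorization_system A CoFib TFib \<and>
            Fib = hom_epics A T\<C> \<and>
            TCoFib = splitting_monos_coker_in A T\<C>))
     \<and>
     (\<forall>CoFib TFib. fibrantly_weak_factorization_system A CoFib TFib \<longrightarrow>
        (let \<C> = objs_from_zero A CoFib;
             \<W> = objs_to_zero A TFib;
             T\<C> = \<C> \<inter> \<W>;
             Fib = hom_epics A T\<C>;
             TCoFib = splitting_monos_coker_in A T\<C>;
             Weq = compose_classes A TFib TCoFib
         in fibrant_model_structure A CoFib Fib Weq))"
proof -
  interpret weakly_idempotent_complete_additive_category A
    by fact
  have fibrant: "fibrant_model_structure A CoFib Fib Weq"
    if "fibrantly_weak_factorization_system A CoFib TFib"
      "Fib = hom_epics A (objs_from_zero A CoFib \<inter> objs_to_zero A TFib)"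
      "Weq = compose_classes A TFib
        (splitting_monos_coker_in A (objs_from_zero A CoFib \<inter> objs_to_zero A TFib))"
    for CoFib TFib Fib Weq
  proof -
    interpret fibrantly_wfs A CoFib TFib
      by unfold_locales (rule that(1))
    show ?thesis
      using fibrant_model that(2,3) by simp
  qed
  show ?thesis
    unfolding Let_def
    by (intro conjI allI impI)
      (erule model_fibrantly_wfs model_fib_eq model_tcofib_eq fibrant[OF _ refl refl])+
qed

end
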